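(* Let $G$ be a countable discrete infinite amenable group, let $(X,G)$ be a $G$-system and let $\mathcal{U}$ be a finite open cover of $X$. Then the function $\mathcal{M}(X,G)\to[0,+\infty)$, $\mu\mapsto h_\mu^-(G,\mathcal{U})$, is upper semi-continuous on $\mathcal{M}(X,G)$.
   Context: Let $F(G)$ be the set of non-empty finite subsets of $G$. A sequence $\{F_n\}_{n\in\mathbb{N}}\subseteq F(G)$ is a Følner sequence if for all $K\in F(G)$ and $\delta>0$ one has $|K^{-1}F_n\cap K^{-1}(G\setminus F_n)|<\delta|F_n|$ for all large $n$. A $G$-system $(X,G)$ is a compact metric space $X$ with a continuous action $G\times X\to X$. $\mathcal{M}(X,G)$ is the set of $G$-invariant Borel probability measures on $X$ with the weak$^*$-topology. A cover of $X$ is a finite family of Borel sets with union $X$; a partition is a cover with pairwise disjoint elements; $\mathcal{P}_X$ is the set of partitions. For covers, $\mathcal{U}\succeq\mathcal{V}$ means each element of $\mathcal{U}$ is contained in some element of $\mathcal{V}$, and $\mathcal{U}\vee\mathcal{V}=\{U\cap V:U\in\mathcal{U},V\in\mathcal{V}\}$. For $F\in F(G)$, $\mathcal{U}_F=\bigvee_{g\in F}g^{-1}\mathcal{U}$. For $\mu\in\mathcal{M}(X,G)$ and $\alpha\in\mathcal{P}_X$, $H_\mu(\alpha)=\sum_{A\in\alpha}-\mu(A)\log\mu(A)$. For a cover $\mathcal{U}$, $H_\mu(\mathcal{U})=\inf\{H_\mu(\alpha):\alpha\in\mathcal{P}_X,\ \alpha\succeq\mathcal{U}\}$ and $h_\mu^-(G,\mathcal{U})=\lim_{n\to+\infty}\frac{1}{|F_n|}H_\mu(\mathcal{U}_{F_n})$;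 the limit exists and does not depend on the Følner sequence $\{F_n\}$. *)

theory Defs
  imports "HOL-Probability.Probability" "HOL-Algebra.Group_Action"
begin

section \<open>Folner sequences and amenability\<close>

definition fin_subsets :: "('g, 'b) monoid_scheme \<Rightarrow> 'g set set" where
  "fin_subsets G = {K. K \<subseteq> carrier G \<and> finite K \<and> K \<noteq> {}}"

definition folner_sequence :: "('g, 'b) monoid_scheme \<Rightarrow> (nat \<Rightarrow> 'g set) \<Rightarrow> bool" where
  "folner_sequence G F \<longleftrightarrow>
     (\<forall>n. F n \<in> fin_subsets G) \<and>
     (\<forall>K \<in> fin_subsets G. \<forall>\<delta>::real. \<delta> > 0 \<longrightarrow>
        (\<forall>\<^sub>F n in sequentially.
           real (card ((set_inv\<^bsub>G\<^esub> K <#>\<^bsub>G\<^esub> F n) \<inter> (set_inv\<^bsub>G\<^esub> K <#>\<^bsub>G\<^esub> (carrier G - F n))))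
             < \<delta> * real (card (F n))))"

text \<open>For a countable discrete group, amenability is the existence of a Folner sequence.\<close>

definition amenable :: "('g, 'b) monoid_scheme \<Rightarrow> bool" where
  "amenable G \<longleftrightarrow> (\<exists>F. folner_sequence G F)"

section \<open>Systems and invariant measures\<close>

text \<open>The compact metric space \<open>X\<close> is the whole type \<^typ>\<open>'x\<close>. The group carries the discrete topology,
  and continuity is joint continuity of the action map.\<close>

definition G_system :: "('g, 'b) monoid_scheme \<Rightarrow> ('g \<Rightarrow> 'x::metric_space \<Rightarrow> 'x) \<Rightarrow> bool" where
  "G_system G \<phi> \<longleftrightarrow>
     compact (UNIV :: 'x set) \<and>
     group_action G UNIV \<phi> \<and>
     continuous_map (prod_topology (discrete_topology (carrier G)) euclidean) euclidean
       (\<lambda>(g, x). \<phi> g x)"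

definition invariant_measures ::
    "('g, 'b) monoid_scheme \<Rightarrow> ('g \<Rightarrow> 'x::metric_space \<Rightarrow> 'x) \<Rightarrow> 'x measure set" where
  "invariant_measures G \<phi> =
     {\<mu>. prob_space \<mu> \<and> sets \<mu> = sets borel \<and> (\<forall>g \<in> carrier G. distr \<mu> borel (\<phi> g) = \<mu>)}"

text \<open>The weak* topology on a set of measures: the coarsest topology for which
  \<open>\<mu> \<mapsto> \<integral>f d\<mu>\<close> is continuous for each continuous real-valued \<open>f\<close>.\<close>

definition weak_star_topology :: "'x::metric_space measure set \<Rightarrow> 'x measure topology" where
  "weak_star_topology S = topology_generated_by
     {{\<mu> \<in> S. (\<integral>x. f x \<partial>\<mu>) \<in> V} | (f :: 'x \<Rightarrow> real) V. continuous_on UNIV f \<and> open V}"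

lemma topspace_weak_star_topology [simp]: "topspace (weak_star_topology S) = S"
proof -
  have "S \<in> {{\<mu> \<in> S. (\<integral>x. f x \<partial>\<mu>) \<in> V} | (f :: 'a \<Rightarrow> real) V. continuous_on UNIV f \<and> open V}"
    by (rule CollectI, rule exI[of _ "\<lambda>_. 0"], rule exI[of _ UNIV]) auto
  then show ?thesis
    unfolding weak_star_topology_def topology_generated_by_topspace by blast
qed

definition upper_semicontinuous :: "'a topology \<Rightarrow> ('a \<Rightarrow> real) \<Rightarrow> bool" where
  "upper_semicontinuous T f \<longleftrightarrow> (\<forall>a. openin T {x \<in> topspace T. f x < a})"

section \<open>Covers and entropy\<close>

definition borel_cover :: "'x::topological_space set set \<Rightarrow> bool" where
  "borel_cover \<U> \<longleftrightarrow> finite \<U> \<and> \<U> \<subseteq> sets borel \<and> \<Union>\<U> = UNIV"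

text \<open>Unlike in \<^const>\<open>partition_on\<close>, the empty set may be an element of a partition; it does not
  contribute to the entropy.\<close>

definition borel_partition :: "'x::topological_space set set \<Rightarrow> bool" where
  "borel_partition \<alpha> \<longleftrightarrow> borel_cover \<alpha> \<and> disjoint \<alpha>"

definition finer :: "'x set set \<Rightarrow> 'x set set \<Rightarrow> bool" where
  "finer \<U> \<V> \<longleftrightarrow> (\<forall>U\<in>\<U>. \<exists>V\<in>\<V>. U \<subseteq> V)"

text \<open>The join of \<open>g\<^sup>-\<^sup>1\<U>\<close> over \<open>g \<in> F\<close>: its elements are the intersections of one member
  \<open>g\<^sup>-\<^sup>1(s g)\<close> of each \<open>g\<^sup>-\<^sup>1\<U>\<close>, the preimage of \<open>s g \<in> \<U>\<close> under the action of \<open>g\<close>.\<close>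

definition dyn_join :: "('g \<Rightarrow> 'x \<Rightarrow> 'x) \<Rightarrow> 'x set set \<Rightarrow> 'g set \<Rightarrow> 'x set set" where
  "dyn_join \<phi> \<U> F = {(\<Inter>g\<in>F. \<phi> g -` s g) | s. s \<in> F \<rightarrow> \<U>}"

definition entropy_partition :: "'x measure \<Rightarrow> 'x set set \<Rightarrow> real" where
  "entropy_partition \<mu> \<alpha> = (\<Sum>A\<in>\<alpha>. - measure \<mu> A * ln (measure \<mu> A))"

definition entropy_cover :: "'x::topological_space measure \<Rightarrow> 'x set set \<Rightarrow> real" where
  "entropy_cover \<mu> \<U> = Inf {entropy_partition \<mu> \<alpha> | \<alpha>. borel_partition \<alpha> \<and> finer \<alpha> \<U>}"

text \<open>\<open>h\<^sub>\<mu>\<^sup>-(G, \<U>)\<close>: the number that is the limit along every Folner sequence.\<close>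

definition h_minus ::
    "('g, 'b) monoid_scheme \<Rightarrow> ('g \<Rightarrow> 'x::topological_space \<Rightarrow> 'x) \<Rightarrow> 'x measure \<Rightarrow> 'x set set \<Rightarrow> real"
  where
  "h_minus G \<phi> \<mu> \<U> =
     (THE h. \<forall>F. folner_sequence G F \<longrightarrow>
        (\<lambda>n. entropy_cover \<mu> (dyn_join \<phi> \<U> (F n)) / real (card (F n))) \<longlonglongrightarrow> h)"

end

theory Submission
  imports Defs
begin

text \<open>
  For a fixed finite set \<open>F\<close> of group elements the function \<open>\<mu> \<mapsto> H\<^sub>\<mu>(\<U>\<^sub>F)\<close> is upper semicontinuous,
  because \<open>\<U>\<^sub>F\<close> is an open cover (\<open>upper_semicontinuous_entropy_cover\<close>).  A pointwise limit of upper
  semicontinuous functions need not be upper semicontinuous, and the usual way out, writing the limit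
  as an infimum over all finite sets \<open>F\<close>, needs strong subadditivity, which \<open>F \<mapsto> H\<^sub>\<mu>(\<U>\<^sub>F)\<close> may lack
  when \<open>\<U>\<close> is a cover and not a partition.  It is only subadditive and invariant under right
  translation of \<open>F\<close> (\<open>invariant_subadditive_entropy\<close>).

  For such functions \<open>h\<close> the Ornstein--Weiss lemma says that \<open>h(F\<^sub>n) / |F\<^sub>n|\<close> converges along every
  Folner sequence, to a limit that does not depend on the sequence.  Its proof compares \<open>h(A)\<close>, for
  a very invariant set \<open>A\<close>, with the values of \<open>h\<close> on tiles whose translates fill \<open>A\<close>.  What makes upper
  semicontinuity work is that this comparison needs finitely many tiles, and that the tiles and the
  invariance asked of \<open>A\<close> depend only on a bound for \<open>h\<close> per element, not on \<open>h\<close> itself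
  (\<open>uniform_ornstein_weiss\<close>).  For all measures, such a bound is the cardinality of one fixed partition
  finer than \<open>\<U>\<close>.

  Now let \<open>h\<^sub>\<mu>\<^sup>-(G, \<U>) < \<rho> < a\<close>.  All late members of a Folner sequence satisfy
  \<open>H\<^sub>\<mu>(\<U>\<^sub>T) < \<rho> |T|\<close>; among them are finitely many tiles \<open>T\<close> such that this inequality for these
  \<open>T\<close> already forces the limit to be at most \<open>\<rho> + \<eta> < a\<close>, for every invariant measure in the place
  of \<open>\<mu>\<close>.  For finitely many \<open>T\<close> the inequality is an open condition on the measure, so it holds on a
  neighbourhood of \<open>\<mu>\<close>.
\<close>

section \<open>Boundaries and fillings in groups\<close>

text \<open>
  The set whose relative size the definition of a Folner sequence controls: the \<open>x\<close> for which the
  translate \<open>K x\<close> meets both \<open>A\<close> and its complement (\<open>mem_folner_boundary_iff\<close>).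
\<close>

definition folner_boundary :: "('g, 'b) monoid_scheme \<Rightarrow> 'g set \<Rightarrow> 'g set \<Rightarrow> 'g set" where
  "folner_boundary G K A =
     (set_inv\<^bsub>G\<^esub> K <#>\<^bsub>G\<^esub> A) \<inter> (set_inv\<^bsub>G\<^esub> K <#>\<^bsub>G\<^esub> (carrier G - A))"

context group
begin

lemma mem_set_inv_mult_iff:
  assumes "K \<subseteq> carrier G" "A \<subseteq> carrier G"
  shows "x \<in> set_inv K <#> A \<longleftrightarrow> x \<in> carrier G \<and> (\<exists>k\<in>K. k \<otimes> x \<in> A)"
proof
  assume "x \<in> set_inv K <#> A"
  then obtain k a where ka: "k \<in> K" "a \<in> A" "x = inv k \<otimes> a"
    unfolding set_mult_def SET_INV_def by blast
  then have "k \<in> carrier G" "a \<in> carrier G" using assms by auto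
  then have "k \<otimes> x = a" using ka by (simp add: m_assoc[symmetric])
  then show "x \<in> carrier G \<and> (\<exists>k\<in>K. k \<otimes> x \<in> A)"
    using ka \<open>k \<in> carrier G\<close> \<open>a \<in> carrier G\<close> by (metis inv_closed m_closed)
next
  assume "x \<in> carrier G \<and> (\<exists>k\<in>K. k \<otimes> x \<in> A)"
  then obtain k where k: "x \<in> carrier G" "k \<in> K" "k \<otimes> x \<in> A" by blast
  then have "k \<in> carrier G" using assms by auto
  then have "x = inv k \<otimes> (k \<otimes> x)" using k by (simp add: m_assoc[symmetric])
  then show "x \<in> set_inv K <#> A"
    unfolding set_mult_def SET_INV_def using k by blast
qed

lemma mem_folner_boundary_iff:
  assumes "K \<subseteq> carrier G" "A \<subseteq> carrier G"
  shows "x \<in> folner_boundary G K A \<longleftrightarrow>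
           x \<in> carrier G \<and> (\<exists>k\<in>K. k \<otimes> x \<in> A) \<and> (\<exists>k\<in>K. k \<otimes> x \<notin> A)"
  unfolding folner_boundary_def Int_iff
  using assms mem_set_inv_mult_iff[OF assms] mem_set_inv_mult_iff[OF assms(1), of "carrier G - A"]
  by auto

lemma finite_folner_boundary:
  assumes "finite K" "finite A"
  shows "finite (folner_boundary G K A)"
proof -
  have "set_inv K <#> A = (\<Union>k\<in>K. \<Union>a\<in>A. {inv k \<otimes> a})"
    unfolding set_mult_def SET_INV_def by blast
  then show ?thesis using assms by (simp add: folner_boundary_def)
qed

lemma folner_boundary_mono:
  assumes "K \<subseteq> L" "L \<subseteq> carrier G" "A \<subseteq> carrier G"
  shows "folner_boundary G K A \<subseteq> folner_boundary G L A"
proof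
  fix x assume "x \<in> folner_boundary G K A"
  then show "x \<in> folner_boundary G L A"
    using assms mem_folner_boundary_iff[of K A x] mem_folner_boundary_iff[of L A x] by blast
qed

lemma r_coset_eq_image: "T #> g = (\<lambda>t. t \<otimes> g) ` T"
  unfolding r_coset_def by blast

lemma card_r_coset:
  assumes "T \<subseteq> carrier G" "g \<in> carrier G"
  shows "card (T #> g) = card T"
  unfolding r_coset_eq_image using assms by (intro card_image inj_onI) (metis right_cancel subsetD)

lemma card_folner_boundary_r_coset:
  assumes "finite K" "finite T" "K \<subseteq> carrier G" "T \<subseteq> carrier G" "g \<in> carrier G"
  shows "card (folner_boundary G K (T #> g)) \<le> card (folner_boundary G K T)"
proof -
  have "folner_boundary G K (T #> g) \<subseteq> (\<lambda>x. x \<otimes> g) ` folner_boundary G K T"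
  proof
    fix x assume "x \<in> folner_boundary G K (T #> g)"
    then have x: "x \<in> carrier G" "\<exists>k\<in>K. k \<otimes> x \<in> T #> g" "\<exists>k\<in>K. k \<otimes> x \<notin> T #> g"
      using mem_folner_boundary_iff[of K "T #> g" x] assms r_coset_subset_G by auto
    have eq: "k \<otimes> x \<in> T #> g \<longleftrightarrow> k \<otimes> (x \<otimes> inv g) \<in> T" if "k \<in> K" for k
    proof
      assume "k \<otimes> x \<in> T #> g"
      then obtain t where t: "t \<in> T" "k \<otimes> x = t \<otimes> g" unfolding r_coset_eq_image by auto
      have "k \<otimes> (x \<otimes> inv g) = t \<otimes> g \<otimes> inv g"
        using that assms x t by (auto simp: m_assoc[symmetric])
      also have "\<dots> = t" using t assms by (auto simp: m_assoc)
      finally show "k \<otimes> (x \<otimes> inv g) \<in> T" using t by simp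
    next
      assume "k \<otimes> (x \<otimes> inv g) \<in> T"
      moreover have "k \<otimes> x = k \<otimes> (x \<otimes> inv g) \<otimes> g"
        using that assms x by (auto simp: m_assoc subset_iff)
      ultimately show "k \<otimes> x \<in> T #> g" unfolding r_coset_eq_image by blast
    qed
    have "x \<otimes> inv g \<in> folner_boundary G K T"
      using x eq assms by (subst mem_folner_boundary_iff) auto
    moreover have "x = x \<otimes> inv g \<otimes> g" using x assms by (simp add: m_assoc)
    ultimately show "x \<in> (\<lambda>x. x \<otimes> g) ` folner_boundary G K T" by blast
  qed
  then show ?thesis
    using assms by (meson finite_folner_boundary surj_card_le)
qed

text \<open>
  Removing translates of an invariant set keeps invariance: if \<open>K x\<close> meets the remainder and its
  complement, then either it leaves \<open>A\<close>, or it enters some \<open>T g\<close> without being contained in it.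
\<close>

lemma folner_boundary_Diff_subset:
  assumes "K \<subseteq> carrier G" "A \<subseteq> carrier G" "T \<subseteq> carrier G" "D \<subseteq> carrier G"
  shows "folner_boundary G K (A - (\<Union>g\<in>D. T #> g)) \<subseteq>
           folner_boundary G K A \<union> (\<Union>g\<in>D. folner_boundary G K (T #> g))"
proof
  fix x assume "x \<in> folner_boundary G K (A - (\<Union>g\<in>D. T #> g))"
  moreover have "A - (\<Union>g\<in>D. T #> g) \<subseteq> carrier G" using assms by auto
  ultimately obtain k l where x: "x \<in> carrier G" "k \<in> K" "k \<otimes> x \<in> A - (\<Union>g\<in>D. T #> g)"
      "l \<in> K" "l \<otimes> x \<notin> A - (\<Union>g\<in>D. T #> g)"
    using mem_folner_boundary_iff[OF assms(1), of "A - (\<Union>g\<in>D. T #> g)" x] by auto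
  show "x \<in> folner_boundary G K A \<union> (\<Union>g\<in>D. folner_boundary G K (T #> g))"
  proof (cases "l \<otimes> x \<in> A")
    case False
    then have "x \<in> folner_boundary G K A"
      using x assms by (subst mem_folner_boundary_iff) auto
    then show ?thesis by simp
  next
    case True
    then obtain g where g: "g \<in> D" "l \<otimes> x \<in> T #> g" using x by auto
    then have "T #> g \<subseteq> carrier G" using assms r_coset_subset_G by blast
    then have "x \<in> folner_boundary G K (T #> g)"
      using x g assms by (subst mem_folner_boundary_iff) auto
    then show ?thesis using g by blast
  qed
qed

text \<open>
  For \<open>t \<in> T\<close> the points \<open>t\<^sup>-\<^sup>1 a\<close> with \<open>a \<in> A\<close> are \<open>card A\<close> many, and for each of them \<open>T (t\<^sup>-\<^sup>1 a)\<close> meets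
  \<open>A\<close>; hence it lies inside \<open>A\<close> or \<open>t\<^sup>-\<^sup>1 a\<close> is a boundary point.
\<close>

lemma card_translates_inside:
  assumes "finite K" "finite A" "finite T" "K \<subseteq> carrier G" "A \<subseteq> carrier G"
    "T \<subseteq> K" "T \<noteq> {}"
  shows "finite {g \<in> carrier G. T #> g \<subseteq> A}"
    and "card A \<le> card {g \<in> carrier G. T #> g \<subseteq> A} + card (folner_boundary G K A)"
proof -
  let ?P = "{g \<in> carrier G. T #> g \<subseteq> A}"
  obtain t where t: "t \<in> T" using assms by blast
  then have tc: "t \<in> carrier G" using assms by blast
  have "?P \<subseteq> (\<lambda>a. inv t \<otimes> a) ` A"
  proof
    fix g assume g: "g \<in> ?P"
    then have "t \<otimes> g \<in> A" using t unfolding r_coset_eq_image by blast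
    moreover have "g = inv t \<otimes> (t \<otimes> g)" using g tc by (simp add: m_assoc[symmetric])
    ultimately show "g \<in> (\<lambda>a. inv t \<otimes> a) ` A" by blast
  qed
  then show fP: "finite ?P" using assms finite_subset by blast
  have "(\<lambda>a. inv t \<otimes> a) ` A \<subseteq> ?P \<union> folner_boundary G K A"
  proof
    fix x assume "x \<in> (\<lambda>a. inv t \<otimes> a) ` A"
    then obtain a where a: "a \<in> A" "x = inv t \<otimes> a" by blast
    then have ac: "a \<in> carrier G" using assms by blast
    then have xc: "x \<in> carrier G" "t \<otimes> x = a" using a tc by (auto simp: m_assoc[symmetric])
    show "x \<in> ?P \<union> folner_boundary G K A"
    proof (cases "T #> x \<subseteq> A")
      case True then show ?thesis using xc by simp
    next
      case False
      then obtain s where "s \<in> T" "s \<otimes> x \<notin> A" unfolding r_coset_eq_image by blast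
      then have "x \<in> folner_boundary G K A"
        using a xc t assms mem_folner_boundary_iff[of K A x] by (metis subsetD)
      then show ?thesis by simp
    qed
  qed
  then have "card ((\<lambda>a. inv t \<otimes> a) ` A) \<le> card (?P \<union> folner_boundary G K A)"
    using fP assms finite_folner_boundary by (intro card_mono) auto
  also have "\<dots> \<le> card ?P + card (folner_boundary G K A)" by (rule card_Un_le)
  also have "card ((\<lambda>a. inv t \<otimes> a) ` A) = card A"
    using tc assms by (intro card_image inj_onI) (metis Units_eq Units_l_cancel inv_closed subsetD)
  finally show "card A \<le> card ?P + card (folner_boundary G K A)" .
qed

text \<open>
  Double counting: a point \<open>u\<close> lies in \<open>T g\<close> only for \<open>g\<close> of the form \<open>t\<^sup>-\<^sup>1 u\<close>, thus in at most \<open>card T\<close>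
  translates.
\<close>

lemma sum_card_translates_Int_le:
  assumes "finite U" "finite T" "finite P" "T \<subseteq> carrier G" "P \<subseteq> carrier G"
  shows "(\<Sum>g\<in>P. card ((T #> g) \<inter> U)) \<le> card T * card U"
proof -
  have "(\<Sum>g\<in>P. card ((T #> g) \<inter> U)) = (\<Sum>g\<in>P. \<Sum>u\<in>U. if u \<in> T #> g then 1 else 0)"
    using assms by (intro sum.cong refl) (simp add: sum.If_cases Int_commute Collect_conj_eq)
  also have "\<dots> = (\<Sum>u\<in>U. \<Sum>g\<in>P. if u \<in> T #> g then 1 else 0)" by (rule sum.swap)
  also have "\<dots> = (\<Sum>u\<in>U. card {g \<in> P. u \<in> T #> g})"
    using assms by (intro sum.cong refl) (simp add: sum.If_cases Collect_conj_eq)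
  also have "\<dots> \<le> (\<Sum>u\<in>U. card T)"
  proof (intro sum_mono)
    fix u assume "u \<in> U"
    have "{g \<in> P. u \<in> T #> g} \<subseteq> (\<lambda>t. inv t \<otimes> u) ` T"
    proof
      fix g assume g: "g \<in> {g \<in> P. u \<in> T #> g}"
      then obtain t where t: "t \<in> T" "u = t \<otimes> g" unfolding r_coset_eq_image by blast
      then have "g = inv t \<otimes> u" using g assms by (auto simp: m_assoc[symmetric] subset_iff)
      then show "g \<in> (\<lambda>t. inv t \<otimes> u) ` T" using t by blast
    qed
    then show "card {g \<in> P. u \<in> T #> g} \<le> card T" using assms by (meson surj_card_le)
  qed
  finally show ?thesis by (simp add: mult.commute)
qed

text \<open>
  The filling step.  Choose a largest set \<open>D\<close> of centres whose translates overlap so little that their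
  union \<open>U\<close> keeps the fraction \<open>1 - \<epsilon>\<close> of the total size.  By maximality every translate of \<open>T\<close> inside
  \<open>A\<close> has at least the fraction \<open>\<epsilon>\<close> of its points in \<open>U\<close>, so double counting makes \<open>U\<close> large.
\<close>

lemma exists_almost_disjoint_translates:
  fixes \<epsilon> :: real
  assumes fin: "finite A" "finite T" "A \<subseteq> carrier G" "T \<subseteq> carrier G" "T \<noteq> {}"
    and \<epsilon>: "0 < \<epsilon>" "\<epsilon> < 1"
    and P: "P = {g \<in> carrier G. T #> g \<subseteq> A}" "finite P"
  obtains D where "D \<subseteq> P" "(1 - \<epsilon>) * card T * card D \<le> card (\<Union>g\<in>D. T #> g)"
    "\<epsilon> * card P \<le> card (\<Union>g\<in>D. T #> g)"
proof -
  let ?U = "\<lambda>D. \<Union>g\<in>D. T #> g"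
  let ?valid = "\<lambda>D. D \<subseteq> P \<and> (1 - \<epsilon>) * card T * card D \<le> card (?U D)"
  have "?valid {}" by simp
  moreover have "\<forall>D. ?valid D \<longrightarrow> card D < Suc (card P)"
    using P card_mono by (auto simp: less_Suc_eq_le)
  ultimately have "\<exists>D. ?valid D \<and> (\<forall>E. ?valid E \<longrightarrow> card E \<le> card D)"
    by (rule ex_has_greatest_nat)
  then obtain D where D: "D \<subseteq> P" "(1 - \<epsilon>) * card T * card D \<le> card (?U D)"
    and max: "\<And>E. ?valid E \<Longrightarrow> card E \<le> card D" by blast
  have fD: "finite D" using D P finite_subset by blast
  have ft: "finite (T #> g)" for g using fin by (simp add: r_coset_eq_image)
  have fU: "finite (?U D)" using fD ft by blast
  have cT: "card T > 0" using fin by (simp add: card_gt_0_iff)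
  have big: "\<epsilon> * card T \<le> card ((T #> g) \<inter> ?U D)" if g: "g \<in> P" for g
  proof (cases "g \<in> D")
    case True
    then have "(T #> g) \<inter> ?U D = T #> g" by blast
    moreover have "card (T #> g) = card T" using card_r_coset fin g P by simp
    ultimately show ?thesis using \<epsilon> by (simp add: mult_left_le_one_le)
  next
    case False
    then have "\<not> ?valid (insert g D)" using max[of "insert g D"] fD by auto
    then have lt: "card (?U (insert g D)) < (1 - \<epsilon>) * card T * (card D + 1)"
      using D g False fD by (simp add: algebra_simps)
    have "card (T #> g) + card (?U D) = card ((T #> g) \<union> ?U D) + card ((T #> g) \<inter> ?U D)"
      using ft fU by (rule card_Un_Int)
    moreover have "card (T #> g) = card T" using card_r_coset fin g P by simp
    moreover have "?U (insert g D) = (T #> g) \<union> ?U D" by simp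
    ultimately have "real (card T) + card (?U D) = card (?U (insert g D)) + card ((T #> g) \<inter> ?U D)"
      by (metis of_nat_add)
    then show ?thesis using lt D by (simp add: algebra_simps)
  qed
  have "card P * (\<epsilon> * card T) \<le> (\<Sum>g\<in>P. real (card ((T #> g) \<inter> ?U D)))"
    using big by (intro sum_bounded_below) auto
  also have "\<dots> = real (\<Sum>g\<in>P. card ((T #> g) \<inter> ?U D))" by simp
  also have "\<dots> \<le> real (card T * card (?U D))"
    using sum_card_translates_Int_le[of "?U D" T P] fin fU P by (intro of_nat_mono) auto
  finally have "card T * (\<epsilon> * card P) \<le> card T * card (?U D)" by (simp add: algebra_simps)
  then have "\<epsilon> * card P \<le> card (?U D)" using cT by simp
  then show ?thesis using D that by blast
qed

end

section \<open>The Ornstein--Weiss lemma, uniformly in the function\<close>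

text \<open>
  Upper bounds suffice for invariance, because they also apply to the inverse translation.
\<close>

definition invariant_subadditive ::
    "('g, 'b) monoid_scheme \<Rightarrow> real \<Rightarrow> ('g set \<Rightarrow> real) \<Rightarrow> bool" where
  "invariant_subadditive G C h \<longleftrightarrow>
     (\<forall>A B. finite A \<longrightarrow> A \<subseteq> carrier G \<longrightarrow> finite B \<longrightarrow> B \<subseteq> carrier G \<longrightarrow> h (A \<union> B) \<le> h A + h B) \<and>
     (\<forall>A g. finite A \<longrightarrow> A \<subseteq> carrier G \<longrightarrow> g \<in> carrier G \<longrightarrow> h (A #>\<^bsub>G\<^esub> g) \<le> h A) \<and>
     (\<forall>A. finite A \<longrightarrow> A \<subseteq> carrier G \<longrightarrow> h A \<le> C * card A)"

text \<open>
  The functions \<open>h\<close> are quantified inside, so that the tiles \<open>\<T>\<close> and the invariance \<open>(K, \<delta>)\<close> serve all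
  of them at once.
\<close>

definition tile_bound ::
    "('g, 'b) monoid_scheme \<Rightarrow> real \<Rightarrow> real \<Rightarrow> 'g set set \<Rightarrow> 'g set \<Rightarrow> real \<Rightarrow> real \<Rightarrow> bool" where
  "tile_bound G C \<rho> \<T> K \<delta> c \<longleftrightarrow>
     (\<forall>h A. invariant_subadditive G C h \<longrightarrow> (\<forall>T\<in>\<T>. h T \<le> \<rho> * real (card T)) \<longrightarrow>
        A \<in> fin_subsets G \<longrightarrow> real (card (folner_boundary G K A)) < \<delta> * real (card A) \<longrightarrow>
        h A \<le> c * real (card A))"

definition has_invariant_sets :: "('g, 'b) monoid_scheme \<Rightarrow> 'g set set \<Rightarrow> bool" where
  "has_invariant_sets G \<S> \<longleftrightarrow>
     (\<forall>K\<in>fin_subsets G. \<forall>\<delta>::real. \<delta> > 0 \<longrightarrow>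
        (\<exists>T\<in>\<S>. T \<in> fin_subsets G \<and> card (folner_boundary G K T) < \<delta> * card T))"

lemma invariant_subadditiveD:
  fixes h :: "'g set \<Rightarrow> real"
  assumes "invariant_subadditive G C h" "finite A" "A \<subseteq> carrier G"
  shows "finite B \<Longrightarrow> B \<subseteq> carrier G \<Longrightarrow> h (A \<union> B) \<le> h A + h B"
    and "g \<in> carrier G \<Longrightarrow> h (A #>\<^bsub>G\<^esub> g) \<le> h A"
    and "h A \<le> C * card A"
  using assms unfolding invariant_subadditive_def by simp_all

lemma tile_boundD:
  assumes "tile_bound G C \<rho> \<T> K \<delta> c" "invariant_subadditive G C h"
    "\<And>T. T \<in> \<T> \<Longrightarrow> h T \<le> \<rho> * real (card T)"
    "A \<in> fin_subsets G" "real (card (folner_boundary G K A)) < \<delta> * real (card A)"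
  shows "h A \<le> c * real (card A)"
  using assms unfolding tile_bound_def by simp

lemma tile_bound_mono:
  assumes tb: "tile_bound G C \<rho> \<T> K \<delta> c" and "c \<le> d"
  shows "tile_bound G C \<rho> \<T> K \<delta> d"
  unfolding tile_bound_def
proof (intro allI impI)
  fix h :: "'a set \<Rightarrow> real" and A
  assume *: "invariant_subadditive G C h" "\<forall>T\<in>\<T>. h T \<le> \<rho> * real (card T)"
    "A \<in> fin_subsets G" "real (card (folner_boundary G K A)) < \<delta> * real (card A)"
  have "h A \<le> c * real (card A)" using * by (intro tile_boundD[OF tb]) auto
  also have "\<dots> \<le> d * real (card A)" using assms by (intro mult_right_mono) auto
  finally show "h A \<le> d * real (card A)" .
qed

context group
begin

lemma invariant_subadditive_translates_le:
  fixes h :: "'a set \<Rightarrow> real"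
  assumes h: "invariant_subadditive G C h" and "finite T" "T \<subseteq> carrier G"
    and "finite D" "D \<subseteq> carrier G"
  shows "h (\<Union>g\<in>D. T #> g) \<le> card D * h T"
  using assms(4,5)
proof (induction D rule: finite_induct)
  case empty
  then show ?case using h unfolding invariant_subadditive_def by force
next
  case (insert g D)
  have "finite (\<Union>g\<in>D. T #> g)" "(\<Union>g\<in>D. T #> g) \<subseteq> carrier G" "finite (T #> g)" "T #> g \<subseteq> carrier G"
    using insert assms r_coset_subset_G by (auto simp: r_coset_eq_image)
  then have "h ((T #> g) \<union> (\<Union>g\<in>D. T #> g)) \<le> h (T #> g) + h (\<Union>g\<in>D. T #> g)"
    by (intro invariant_subadditiveD(1)[OF h])
  moreover have "h (T #> g) \<le> h T"
    using assms insert by (intro invariant_subadditiveD(2)[OF h]) auto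
  ultimately show ?case using insert by (simp add: algebra_simps)
qed

text \<open>
  A self-improvement of the constant.  Take one more tile \<open>T\<close> that is itself sufficiently
  \<open>K\<close>-invariant, and fill \<open>A\<close> with translates of \<open>T\<close> as above.  Their union \<open>U\<close> has at least the
  fraction \<open>\<epsilon>/2\<close> of \<open>A\<close>, and on it \<open>h\<close> costs at most \<open>\<rho> / (1 - \<epsilon>)\<close> per point.  The remainder is
  either smaller than \<open>\<epsilon> |A|\<close>, so that \<open>\<rho> / (1 - \<epsilon>) + C \<epsilon>\<close> bounds the cost per point of \<open>A\<close>, or
  it is still invariant enough for the old constant \<open>c\<close>, and then a proper convex combination of \<open>c\<close>
  and \<open>\<rho> / (1 - \<epsilon>)\<close> does.
\<close>

lemma tile_bound_improve:
  fixes \<epsilon> :: real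
  assumes \<epsilon>: "0 < \<epsilon>" "\<epsilon> \<le> 1/2" and lam: "0 \<le> \<rho>" and C: "0 \<le> C"
    and c: "\<rho> / (1 - \<epsilon>) \<le> c"
    and S: "has_invariant_sets G \<S>"
    and tb: "tile_bound G C \<rho> \<T> K \<delta> c" and \<T>: "finite \<T>" "\<T> \<subseteq> \<S> \<inter> fin_subsets G"
    and K: "K \<in> fin_subsets G" and \<delta>: "\<delta> > 0"
  obtains \<T>' K' \<delta>' where "finite \<T>'" "\<T>' \<subseteq> \<S> \<inter> fin_subsets G" "K' \<in> fin_subsets G" "\<delta>' > 0"
    "tile_bound G C \<rho> \<T>' K' \<delta>'
       (max (\<rho> / (1 - \<epsilon>) + C * \<epsilon>) (\<epsilon>/2 * (\<rho> / (1 - \<epsilon>)) + (1 - \<epsilon>/2) * c))"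
proof -
  \<comment> \<open>the boundary of the remainder is below \<open>3 \<delta>1 |A|\<close>, and the remainder has at least \<open>\<epsilon> |A|\<close> points\<close>
  define \<delta>1 where "\<delta>1 = \<epsilon> * \<delta> / 3"
  have \<delta>1: "\<delta>1 > 0" unfolding \<delta>1_def using \<epsilon> \<delta> by simp
  obtain T where T: "T \<in> \<S>" "T \<in> fin_subsets G" "card (folner_boundary G K T) < \<delta>1 * card T"
    using S K \<delta>1 unfolding has_invariant_sets_def by blast
  have T': "finite T" "T \<subseteq> carrier G" "T \<noteq> {}" and K': "finite K" "K \<subseteq> carrier G"
    using T K by (auto simp: fin_subsets_def)
  define b where "b = \<rho> / (1 - \<epsilon>)"
  have b: "b \<ge> 0" "\<rho> = b * (1 - \<epsilon>)" using \<epsilon> lam by (auto simp: b_def)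
  have "tile_bound G C \<rho> (insert T \<T>) (K \<union> T) (min \<delta>1 (1/2))
       (max (b + C * \<epsilon>) (\<epsilon>/2 * b + (1 - \<epsilon>/2) * c))"
    unfolding tile_bound_def
  proof (intro allI impI)
    fix h :: "'a set \<Rightarrow> real" and A
    assume h: "invariant_subadditive G C h" and hT: "\<forall>S\<in>insert T \<T>. h S \<le> \<rho> * card S"
      and A: "A \<in> fin_subsets G"
      and inv: "card (folner_boundary G (K \<union> T) A) < min \<delta>1 (1/2) * card A"
    have A': "finite A" "A \<subseteq> carrier G" "A \<noteq> {}" using A by (auto simp: fin_subsets_def)
    have cA: "card A > 0" using A' by (simp add: card_gt_0_iff)
    have fKT: "finite (folner_boundary G (K \<union> T) A)"
      using A' K' T' finite_folner_boundary by simp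
    have inv1: "card (folner_boundary G (K \<union> T) A) \<le> \<delta>1 * card A"
      and inv2: "card (folner_boundary G (K \<union> T) A) \<le> 1/2 * card A"
      using inv by (simp_all add: min_mult_distrib_right split: if_splits)
    define P where "P = {g \<in> carrier G. T #> g \<subseteq> A}"
    have fP: "finite P" and cP: "card A \<le> card P + card (folner_boundary G (K \<union> T) A)"
      using card_translates_inside[of "K \<union> T" A T] A' K' T' unfolding P_def by auto
    have P2: "real (card P) \<ge> card A / 2" using cP inv2 by linarith
    obtain D where D: "D \<subseteq> P" and D1: "(1 - \<epsilon>) * card T * card D \<le> card (\<Union>g\<in>D. T #> g)"
      and D2: "\<epsilon> * card P \<le> card (\<Union>g\<in>D. T #> g)"
      using exists_almost_disjoint_translates[OF A'(1) T'(1) A'(2) T'(2,3) \<epsilon>(1) _ P_def fP] \<epsilon>(2)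
      by auto
    define U where "U = (\<Union>g\<in>D. T #> g)"
    have fD: "finite D" "D \<subseteq> carrier G" using D fP finite_subset by (auto simp: P_def)
    have UA: "U \<subseteq> A" using D by (auto simp: U_def P_def)
    then have fU: "finite U" using A' finite_subset by blast
    have cU: "real (card (A - U)) = real (card A) - real (card U)" "card U \<le> card A"
      using UA fU A' by (auto simp: card_Diff_subset card_mono of_nat_diff)
    have U2: "real (card U) \<ge> \<epsilon>/2 * card A"
      using D2 mult_left_mono[OF P2, of \<epsilon>] \<epsilon> unfolding U_def by linarith
    have "h U \<le> card D * h T"
      unfolding U_def using invariant_subadditive_translates_le h T' fD by blast
    also have "\<dots> \<le> card D * (\<rho> * card T)" using hT by (intro mult_left_mono) auto
    also have "\<dots> = b * ((1 - \<epsilon>) * card T * card D)" by (simp add: b(2))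
    also have "\<dots> \<le> b * card U" using D1 b unfolding U_def by (intro mult_left_mono) auto
    finally have hU: "h U \<le> b * card U" .
    have fin': "finite (A - U)" "A - U \<subseteq> carrier G" using A' by auto
    have "h A \<le> h U + h (A - U)"
    proof -
      have "h (U \<union> (A - U)) \<le> h U + h (A - U)"
        using fU fin' UA A' by (intro invariant_subadditiveD(1)[OF h]) auto
      moreover have "U \<union> (A - U) = A" using UA by blast
      ultimately show ?thesis by simp
    qed
    then have hA: "h A \<le> b * card U + h (A - U)" using hU by simp
    show "h A \<le> max (b + C * \<epsilon>) (\<epsilon>/2 * b + (1 - \<epsilon>/2) * c) * card A"
    proof (cases "real (card (A - U)) < \<epsilon> * card A")
      case True
      have "h (A - U) \<le> C * card (A - U)"
        using fin' by (intro invariant_subadditiveD(3)[OF h])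
      also have "\<dots> \<le> C * (\<epsilon> * card A)" using True C by (intro mult_left_mono) auto
      finally have "h A \<le> b * card U + C * (\<epsilon> * card A)" using hA by simp
      also have "\<dots> \<le> b * card A + C * (\<epsilon> * card A)"
        using cU b by (intro add_right_mono mult_left_mono) auto
      also have "\<dots> = (b + C * \<epsilon>) * card A" by (simp add: algebra_simps)
      also have "\<dots> \<le> max (b + C * \<epsilon>) (\<epsilon>/2 * b + (1 - \<epsilon>/2) * c) * card A"
        by (intro mult_right_mono) auto
      finally show ?thesis .
    next
      case False
      then have big: "real (card (A - U)) \<ge> \<epsilon> * card A" by simp
      then have "real (card (A - U)) > 0" using cA \<epsilon> by (smt (verit) mult_pos_pos of_nat_0_less_iff)
      then have "A - U \<noteq> {}" by (metis card.empty less_irrefl of_nat_0)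
      with fin' have fs: "A - U \<in> fin_subsets G" by (simp only: fin_subsets_def mem_Collect_eq simp_thms)
      have "folner_boundary G K (A - U) \<subseteq>
              folner_boundary G (K \<union> T) A \<union> (\<Union>g\<in>D. folner_boundary G K (T #> g))"
        unfolding U_def
      proof (rule order_trans[OF folner_boundary_Diff_subset[OF K'(2) A'(2) T'(2) fD(2)]])
        have "folner_boundary G K A \<subseteq> folner_boundary G (K \<union> T) A"
          using A' K' T' by (intro folner_boundary_mono) auto
        then show "folner_boundary G K A \<union> (\<Union>g\<in>D. folner_boundary G K (T #> g)) \<subseteq>
              folner_boundary G (K \<union> T) A \<union> (\<Union>g\<in>D. folner_boundary G K (T #> g))"
          by (rule Un_mono) simp
      qed
      then have "card (folner_boundary G K (A - U)) \<le>
              card (folner_boundary G (K \<union> T) A \<union> (\<Union>g\<in>D. folner_boundary G K (T #> g)))"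
        using fKT fD K' T' by (intro card_mono) (auto intro!: finite_folner_boundary simp: r_coset_eq_image)
      also have "\<dots> \<le> card (folner_boundary G (K \<union> T) A)
                     + card (\<Union>g\<in>D. folner_boundary G K (T #> g))" by (rule card_Un_le)
      also have "card (\<Union>g\<in>D. folner_boundary G K (T #> g))
                   \<le> (\<Sum>g\<in>D. card (folner_boundary G K (T #> g)))" using fD by (intro card_UN_le)
      also have "\<dots> \<le> (\<Sum>g\<in>D. card (folner_boundary G K T))"
        using fD K' T' by (intro sum_mono card_folner_boundary_r_coset) auto
      finally have "card (folner_boundary G K (A - U)) \<le>
          card (folner_boundary G (K \<union> T) A) + card D * card (folner_boundary G K T)" by simp
      then have "real (card (folner_boundary G K (A - U))) \<le>
          card (folner_boundary G (K \<union> T) A) + card D * real (card (folner_boundary G K T))"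
        by (metis of_nat_add of_nat_mono of_nat_mult)
      also have "\<dots> \<le> \<delta>1 * card A + card D * (\<delta>1 * card T)"
        using inv1 T by (intro add_mono mult_left_mono) auto
      also have "\<dots> < \<delta>1 * card A + \<delta>1 * 2 * card A"
      proof -
        have "1/2 * (real (card T) * card D) \<le> (1 - \<epsilon>) * (real (card T) * card D)"
          using \<epsilon> by (intro mult_right_mono) auto
        then have le: "real (card T) * card D \<le> 2 * card U"
          using D1 unfolding U_def by (simp add: algebra_simps)
        moreover have "real (card U) < card A" using cU \<open>real (card (A - U)) > 0\<close> by linarith
        ultimately have "real (card T) * card D < 2 * card A" by linarith
        from mult_strict_left_mono[OF this \<delta>1] show ?thesis by (simp add: algebra_simps)
      qed
      also have "\<dots> = \<delta> * (\<epsilon> * card A)" unfolding \<delta>1_def by (simp add: algebra_simps)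
      also have "\<dots> \<le> \<delta> * card (A - U)" using big \<delta> by simp
      finally have "h (A - U) \<le> c * card (A - U)"
        using hT by (intro tile_boundD[OF tb h _ fs]) auto
      then have "h A \<le> b * card U + c * (real (card A) - real (card U))" using hA cU by simp
      also have "\<dots> = c * card A - (c - b) * card U" by (simp add: algebra_simps)
      also have "\<dots> \<le> c * card A - (c - b) * (\<epsilon>/2 * card A)"
        using U2 c unfolding b_def by (intro diff_left_mono mult_left_mono) auto
      also have "\<dots> = (\<epsilon>/2 * b + (1 - \<epsilon>/2) * c) * card A" by (simp add: field_simps)
      also have "\<dots> \<le> max (b + C * \<epsilon>) (\<epsilon>/2 * b + (1 - \<epsilon>/2) * c) * card A"
        by (intro mult_right_mono) auto
      finally show ?thesis .
    qed
  qed
  moreover have "K \<union> T \<in> fin_subsets G" using K' T' by (auto simp: fin_subsets_def)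
  ultimately show ?thesis
    using that[of "insert T \<T>" "K \<union> T" "min \<delta>1 (1/2)"] \<T> T \<delta>1 unfolding b_def by simp
qed

text \<open>
  Iterating the improvement, the excess of the constant over \<open>\<rho> / (1 - \<epsilon>) + C \<epsilon>\<close> shrinks by the
  factor \<open>1 - \<epsilon>/2\<close> in each step.  Every step adds a single tile, hence finitely many tiles are enough.
\<close>

theorem uniform_ornstein_weiss:
  assumes lam: "0 \<le> \<rho>" and C: "0 \<le> C" and \<eta>: "0 < \<eta>" and S: "has_invariant_sets G \<S>"
  obtains \<T> K \<delta> where "finite \<T>" "\<T> \<subseteq> \<S> \<inter> fin_subsets G" "K \<in> fin_subsets G" "\<delta> > 0"
    "tile_bound G C \<rho> \<T> K \<delta> (\<rho> + \<eta>)"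
proof -
  \<comment> \<open>chosen so that \<open>\<rho> / (1 - \<epsilon>) + C \<epsilon> \<le> \<rho> + \<eta>/2\<close>, using \<open>1 / (1 - \<epsilon>) \<le> 1 + 2 \<epsilon>\<close> for \<open>\<epsilon> \<le> 1/2\<close>\<close>
  define \<epsilon> where "\<epsilon> = min (1/2) (\<eta> / (2 * (2 * \<rho> + C + 1)))"
  have \<epsilon>: "0 < \<epsilon>" "\<epsilon> \<le> 1/2" "\<epsilon> \<le> \<eta> / (2 * (2 * \<rho> + C + 1))"
    unfolding \<epsilon>_def using \<eta> lam C by (simp_all add: add_nonneg_pos del: min_less_iff_conj) (simp_all add: add_nonneg_pos min_def)
  define b where "b = \<rho> / (1 - \<epsilon>)"
  have b0: "b \<ge> 0" using \<epsilon> lam by (simp add: b_def)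
  have "\<rho> \<le> (\<rho> + 2 * \<rho> * \<epsilon>) * (1 - \<epsilon>)"
  proof -
    have "0 \<le> \<rho> * \<epsilon> * (1 - 2 * \<epsilon>)" using lam \<epsilon> by simp
    then show ?thesis by (simp add: algebra_simps)
  qed
  then have "b \<le> \<rho> + 2 * \<rho> * \<epsilon>" using \<epsilon> by (simp add: b_def pos_divide_le_eq)
  moreover have "\<epsilon> * (2 * (2 * \<rho> + C + 1)) \<le> \<eta>"
    using \<epsilon>(3) lam C by (subst (asm) pos_le_divide_eq) auto
  ultimately have b: "b + C * \<epsilon> \<le> \<rho> + \<eta>/2" using \<epsilon>(1) by (simp add: algebra_simps)
  define q where "q = 1 - \<epsilon>/2"
  have q: "0 \<le> q" "q < 1" using \<epsilon> by (auto simp: q_def)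
  have bounds: "\<exists>\<T> K \<delta>. finite \<T> \<and> \<T> \<subseteq> \<S> \<inter> fin_subsets G \<and> K \<in> fin_subsets G \<and> \<delta> > 0 \<and>
          tile_bound G C \<rho> \<T> K \<delta> (b + C * \<epsilon> + q ^ n * C)" for n
  proof (induction n)
    case 0
    have "tile_bound G C \<rho> {} {\<one>} 1 (b + C * \<epsilon> + q ^ 0 * C)"
      unfolding tile_bound_def
    proof (intro allI impI)
      fix h :: "'a set \<Rightarrow> real" and A
      assume h: "invariant_subadditive G C h" and A: "A \<in> fin_subsets G"
      then have "h A \<le> C * card A"
        using A by (intro invariant_subadditiveD(3)[OF h]) (auto simp: fin_subsets_def)
      also have "\<dots> \<le> (b + C * \<epsilon> + q ^ 0 * C) * card A"
        using b0 C \<epsilon> by (intro mult_right_mono) auto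
      finally show "h A \<le> (b + C * \<epsilon> + q ^ 0 * C) * card A" .
    qed
    moreover have "{\<one>} \<in> fin_subsets G" by (simp add: fin_subsets_def)
    ultimately show ?case by (intro exI[of _ "{}"] exI[of _ "{\<one>}"] exI[of _ 1]) auto
  next
    case (Suc n)
    then obtain \<T> K \<delta> where IH: "finite \<T>" "\<T> \<subseteq> \<S> \<inter> fin_subsets G" "K \<in> fin_subsets G" "\<delta> > 0"
        "tile_bound G C \<rho> \<T> K \<delta> (b + C * \<epsilon> + q ^ n * C)" by blast
    have "\<rho> / (1 - \<epsilon>) \<le> b + C * \<epsilon> + q ^ n * C"
      using C \<epsilon> q by (simp add: b_def)
    from tile_bound_improve[OF \<epsilon>(1,2) lam C this S IH(5,1,2,3,4)]
    obtain \<T>' K' \<delta>' where n: "finite \<T>'" "\<T>' \<subseteq> \<S> \<inter> fin_subsets G" "K' \<in> fin_subsets G" "\<delta>' > 0"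
      "tile_bound G C \<rho> \<T>' K' \<delta>'
        (max (\<rho> / (1 - \<epsilon>) + C * \<epsilon>) (\<epsilon>/2 * (\<rho> / (1 - \<epsilon>)) + (1 - \<epsilon>/2) * (b + C * \<epsilon> + q ^ n * C)))"
      by metis
    have "max (\<rho> / (1 - \<epsilon>) + C * \<epsilon>) (\<epsilon>/2 * (\<rho> / (1 - \<epsilon>)) + (1 - \<epsilon>/2) * (b + C * \<epsilon> + q ^ n * C))
            \<le> b + C * \<epsilon> + q ^ Suc n * C"
    proof (rule max.boundedI)
      show "\<rho> / (1 - \<epsilon>) + C * \<epsilon> \<le> b + C * \<epsilon> + q ^ Suc n * C"
        unfolding b_def[symmetric] using q C by simp
      have "\<epsilon>/2 * b + q * (b + C * \<epsilon> + q ^ n * C) = b + q * (C * \<epsilon>) + q ^ Suc n * C"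
        by (simp add: q_def algebra_simps)
      also have "q * (C * \<epsilon>) \<le> C * \<epsilon>" using q C \<epsilon> by (intro mult_left_le_one_le) auto
      finally show "\<epsilon>/2 * (\<rho> / (1 - \<epsilon>)) + (1 - \<epsilon>/2) * (b + C * \<epsilon> + q ^ n * C)
                      \<le> b + C * \<epsilon> + q ^ Suc n * C"
        unfolding b_def[symmetric] q_def[symmetric] by simp
    qed
    then have "tile_bound G C \<rho> \<T>' K' \<delta>' (b + C * \<epsilon> + q ^ Suc n * C)"
      by (rule tile_bound_mono[OF n(5)])
    then show ?case using n by blast
  qed
  have "\<exists>n. q ^ n * C \<le> \<eta>/2"
  proof -
    have "(\<lambda>n. q ^ n * C) \<longlonglongrightarrow> 0 * C"
      using q by (intro tendsto_mult tendsto_const LIMSEQ_realpow_zero) auto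
    then have "\<forall>\<^sub>F n in sequentially. q ^ n * C < \<eta>/2"
      using \<eta> by (intro order_tendstoD(2)) auto
    then show ?thesis by (meson eventually_sequentially less_imp_le order_refl)
  qed
  then obtain n where n: "q ^ n * C \<le> \<eta>/2" by blast
  obtain \<T> K \<delta> where R: "finite \<T>" "\<T> \<subseteq> \<S> \<inter> fin_subsets G" "K \<in> fin_subsets G" "\<delta> > 0"
        "tile_bound G C \<rho> \<T> K \<delta> (b + C * \<epsilon> + q ^ n * C)" using bounds[of n] by blast
  have "b + C * \<epsilon> + q ^ n * C \<le> \<rho> + \<eta>" using n b by simp
  then have "tile_bound G C \<rho> \<T> K \<delta> (\<rho> + \<eta>)"
    by (rule tile_bound_mono[OF R(5)])
  then show ?thesis using that R by blast
qed

lemma folner_sequence_invariant: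
  assumes "folner_sequence G F" "K \<in> fin_subsets G" "\<delta> > 0"
  shows "\<forall>\<^sub>F n in sequentially. real (card (folner_boundary G K (F n))) < \<delta> * real (card (F n))"
  using assms unfolding folner_sequence_def folner_boundary_def by blast

lemma folner_sequence_card_pos:
  assumes "folner_sequence G F"
  shows "0 < card (F n)"
proof -
  have "F n \<in> fin_subsets G" using assms by (simp add: folner_sequence_def)
  then show ?thesis by (simp add: fin_subsets_def card_gt_0_iff)
qed

lemma has_invariant_sets_frequently:
  assumes F: "folner_sequence G F" and P: "\<exists>\<^sub>F n in sequentially. P (F n)"
  shows "has_invariant_sets G {T. P T}"
  unfolding has_invariant_sets_def
proof (intro ballI allI impI)
  fix K and \<delta> :: real assume "K \<in> fin_subsets G" "\<delta> > 0"
  from frequently_eventually_frequently[OF P folner_sequence_invariant[OF F this]]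
  obtain n where "P (F n)" "card (folner_boundary G K (F n)) < \<delta> * card (F n)"
    by (auto dest: frequently_ex)
  moreover have "F n \<in> fin_subsets G" using F by (simp add: folner_sequence_def)
  ultimately show "\<exists>T\<in>{T. P T}. T \<in> fin_subsets G \<and> card (folner_boundary G K T) < \<delta> * card T"
    by blast
qed

lemma tile_bound_eventually:
  fixes h :: "'a set \<Rightarrow> real"
  assumes "folner_sequence G F" "K \<in> fin_subsets G" "\<delta> > 0" "tile_bound G C \<rho> \<T> K \<delta> c"
    "invariant_subadditive G C h" "\<And>T. T \<in> \<T> \<Longrightarrow> h T \<le> \<rho> * card T"
  shows "\<forall>\<^sub>F n in sequentially. h (F n) / card (F n) \<le> c"
  using folner_sequence_invariant[OF assms(1,2,3)]
proof eventually_elim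
  case (elim n)
  have "F n \<in> fin_subsets G" using assms(1) by (simp add: folner_sequence_def)
  then have "h (F n) \<le> c * card (F n)" by (intro tile_boundD[OF assms(4,5,6) _ elim])
  then show ?case using folner_sequence_card_pos[OF assms(1), of n] by (simp add: pos_divide_le_eq)
qed

text \<open>
  The limit is the least asymptotic upper bound common to all Folner sequences.  If some sequence had
  values frequently below \<open>a < L\<close>, these sets could serve as tiles, and the uniform bound would give
  the smaller common bound \<open>a + \<eta> < L\<close>.
\<close>

theorem ornstein_weiss:
  fixes h :: "'a set \<Rightarrow> real"
  assumes h: "invariant_subadditive G C h" and C: "0 \<le> C" and pos: "\<And>A. A \<in> fin_subsets G \<Longrightarrow> 0 \<le> h A"
  obtains L where "0 \<le> L" "\<And>F. folner_sequence G F \<Longrightarrow> (\<lambda>n. h (F n) / card (F n)) \<longlonglongrightarrow> L"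
proof -
  define \<Lambda> where "\<Lambda> = {\<rho>. 0 \<le> \<rho> \<and>
    (\<forall>F. folner_sequence G F \<longrightarrow> (\<forall>\<^sub>F n in sequentially. h (F n) / card (F n) \<le> \<rho>))}"
  have "h (F n) / card (F n) \<le> C" if F: "folner_sequence G F" for F n
  proof -
    have "h (F n) \<le> C * card (F n)"
      using F by (intro invariant_subadditiveD(3)[OF h]) (auto simp: folner_sequence_def fin_subsets_def)
    then show ?thesis using folner_sequence_card_pos[OF F, of n] by (simp add: pos_divide_le_eq)
  qed
  then have C\<Lambda>: "C \<in> \<Lambda>" unfolding \<Lambda>_def using C by simp
  have bdd: "bdd_below \<Lambda>" by (rule bdd_belowI[of _ 0]) (simp add: \<Lambda>_def)
  define L where "L = Inf \<Lambda>"
  have L0: "0 \<le> L" unfolding L_def using C\<Lambda> by (intro cInf_greatest) (auto simp: \<Lambda>_def)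
  have "(\<lambda>n. h (F n) / card (F n)) \<longlonglongrightarrow> L" if F: "folner_sequence G F" for F
  proof (rule order_tendstoI)
    fix a assume "L < a"
    then obtain \<rho> where l: "\<rho> \<in> \<Lambda>" "\<rho> < a"
      unfolding L_def using cInf_lessD[of \<Lambda> a] C\<Lambda> by blast
    then have "\<forall>\<^sub>F n in sequentially. h (F n) / card (F n) \<le> \<rho>" using F by (simp add: \<Lambda>_def)
    then show "\<forall>\<^sub>F n in sequentially. h (F n) / card (F n) < a"
      by eventually_elim (use l in simp)
  next
    fix a assume a: "a < L"
    show "\<forall>\<^sub>F n in sequentially. a < h (F n) / card (F n)"
    proof (rule ccontr)
      assume "\<not> (\<forall>\<^sub>F n in sequentially. a < h (F n) / card (F n))"
      then have "\<exists>\<^sub>F n in sequentially. h (F n) / card (F n) \<le> a"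
        by (simp add: not_eventually not_less)
      then have fr: "\<exists>\<^sub>F n in sequentially. h (F n) \<le> a * card (F n)"
        using folner_sequence_card_pos[OF F] by (simp add: pos_divide_le_eq)
      then obtain n where "h (F n) \<le> a * card (F n)" by (auto dest: frequently_ex)
      moreover have "0 \<le> h (F n)" using pos F by (simp add: folner_sequence_def)
      ultimately have "0 \<le> a * card (F n)" by linarith
      then have a0: "0 \<le> a" using folner_sequence_card_pos[OF F, of n]
        by (simp add: zero_le_mult_iff)
      define \<eta> where "\<eta> = (L - a) / 2"
      have \<eta>: "0 < \<eta>" using a by (simp add: \<eta>_def)
      obtain \<T> K \<delta> where R: "finite \<T>" "\<T> \<subseteq> {T. h T \<le> a * card T} \<inter> fin_subsets G"
          "K \<in> fin_subsets G" "\<delta> > 0" "tile_bound G C a \<T> K \<delta> (a + \<eta>)"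
        using uniform_ornstein_weiss[OF a0 C \<eta> has_invariant_sets_frequently[OF F fr]] by blast
      have "a + \<eta> \<in> \<Lambda>"
        unfolding \<Lambda>_def using tile_bound_eventually[OF _ R(3,4,5) h] R(2) a0 \<eta> by auto
      then have "L \<le> a + \<eta>" unfolding L_def using bdd by (rule cInf_lower)
      then show False using a by (simp add: \<eta>_def field_simps)
    qed
  qed
  then show ?thesis using that L0 by blast
qed

end

section \<open>Closed approximation and bump functions\<close>

text \<open>
  An open set is the increasing union of the closed sets of points at distance at least \<open>1 / (n + 1)\<close>
  from its complement.
\<close>

lemma open_closed_approx:
  fixes M :: "'a::metric_space measure"
  assumes M: "finite_measure M" and sets: "sets M = sets borel" and U: "open U" and e: "0 < e"
  obtains K where "closed K" "K \<subseteq> U" "measure M (U - K) < e"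
proof (cases "U = UNIV")
  case True
  then show ?thesis using that[of UNIV] e by simp
next
  case False
  interpret finite_measure M by (rule M)
  define K where "K n = {x. 1 / real (Suc n) \<le> infdist x (- U)}" for n
  have cl: "closed (K n)" for n
    unfolding K_def by (intro closed_Collect_le continuous_intros)
  have sub: "K n \<subseteq> U" for n
  proof
    fix x assume "x \<in> K n"
    then have "0 < infdist x (- U)" unfolding K_def
      by (smt (verit) divide_pos_pos mem_Collect_eq of_nat_0_less_iff zero_less_Suc)
    then show "x \<in> U" by (metis ComplI infdist_zero less_irrefl)
  qed
  have inc: "incseq K"
  proof (rule incseq_SucI, rule subsetI)
    fix n x assume "x \<in> K n"
    moreover have "1 / real (Suc (Suc n)) \<le> 1 / real (Suc n)" by (intro divide_left_mono) auto
    ultimately show "x \<in> K (Suc n)" unfolding K_def by simp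
  qed
  have "(\<Union>n. K n) = U"
  proof
    show "(\<Union>n. K n) \<subseteq> U" using sub by blast
    show "U \<subseteq> (\<Union>n. K n)"
    proof
      fix x assume "x \<in> U"
      then have "0 < infdist x (- U)"
        using U False infdist_pos_not_in_closed[of "- U" x] by auto
      then obtain n where "1 / real (Suc n) < infdist x (- U)"
        using nat_approx_posE by metis
      then show "x \<in> (\<Union>n. K n)" unfolding K_def by (auto intro: less_imp_le)
    qed
  qed
  moreover have "range K \<subseteq> sets M" using cl sets by auto
  ultimately have "(\<lambda>n. measure M (K n)) \<longlonglongrightarrow> measure M U"
    using finite_Lim_measure_incseq[OF _ inc] by simp
  then have "\<forall>\<^sub>F n in sequentially. measure M U - e < measure M (K n)"
    using e by (intro order_tendstoD(1)) auto
  then obtain n where n: "measure M U - e < measure M (K n)"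
    by (meson eventually_sequentially order_refl)
  have "measure M (U - K n) = measure M U - measure M (K n)"
    using cl sub U sets by (intro finite_measure_Diff) auto
  then show ?thesis using that[of "K n"] cl sub n by simp
qed

text \<open>
  Regularity of finite Borel measures on metric spaces.  Approximation from inside and from outside
  are proved together, since complements exchange them.
\<close>

lemma closed_open_approx:
  fixes M :: "'a::metric_space measure"
  assumes M: "finite_measure M" and sets: "sets M = sets borel" and B: "B \<in> sets borel" and e: "0 < e"
  shows "\<exists>K U. closed K \<and> open U \<and> K \<subseteq> B \<and> B \<subseteq> U \<and> measure M (U - K) < e"
proof -
  interpret finite_measure M by (rule M)
  have "B \<in> sigma_sets UNIV {S. open S}" using B by (simp add: borel_def)
  then show ?thesis using e
  proof (induction arbitrary: e rule: sigma_sets.induct)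
    case (Basic a)
    then show ?case using open_closed_approx[OF M sets, of a e] by (metis mem_Collect_eq order_refl)
  next
    case Empty
    then show ?case by (intro exI[of _ "{}"]) simp
  next
    case (Compl a)
    obtain K U where KU: "closed K" "open U" "K \<subseteq> a" "a \<subseteq> U" "measure M (U - K) < e"
      using Compl.IH[OF Compl.prems] by (elim exE conjE)
    have "- K - - U = U - K" by blast
    moreover have "- U \<subseteq> UNIV - a" "UNIV - a \<subseteq> - K" using KU(3,4) by blast+
    ultimately show ?case
      using KU(1,2,5) by (intro exI[of _ "- U"] exI[of _ "- K"]) (simp add: closed_Compl open_Compl)
  next
    case (Union a)
    have "\<exists>K U. closed K \<and> open U \<and> K \<subseteq> a i \<and> a i \<subseteq> U \<and> measure M (U - K) < e/2 * (1/2) ^ Suc i" for i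
      using Union.prems by (intro Union.IH) simp
    then obtain K U where KU: "\<And>i. closed (K i)" "\<And>i. open (U i)" "\<And>i. K i \<subseteq> a i" "\<And>i. a i \<subseteq> U i"
        "\<And>i. measure M (U i - K i) < e/2 * (1/2) ^ Suc i"
      by metis
    define V where "V = (\<Union>i. U i)"
    define R where "R n = V - (\<Union>i\<le>n. K i)" for n
    have oV: "open V" unfolding V_def using KU(2) by (intro open_UN) simp
    have mK: "K i \<in> sets M" "U i \<in> sets M" for i using KU(1,2)[of i] sets by simp_all
    have mV: "V \<in> sets M" using oV sets by simp
    have "R n \<in> sets M" for n unfolding R_def using mK(1) mV by (intro sets.Diff sets.finite_UN) simp_all
    then have mR: "range R \<subseteq> sets M" by blast
    have dec: "decseq R" unfolding R_def decseq_def by (intro allI impI Diff_mono UN_mono) simp_all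
    have ss: "(\<lambda>i. e/2 * (1/2) ^ Suc i) sums (e/2 * 1)"
      by (intro sums_mult power_half_series)
    have sm: "summable (\<lambda>i. measure M (U i - K i))"
      using less_imp_le[OF KU(5)] by (intro summable_comparison_test'[OF sums_summable[OF ss], of 0]) simp
    have "measure M (\<Inter>n. R n) \<le> measure M (\<Union>i. U i - K i)"
    proof (rule finite_measure_mono)
      show "(\<Inter>n. R n) \<subseteq> (\<Union>i. U i - K i)" unfolding R_def V_def by blast
      show "(\<Union>i. U i - K i) \<in> sets M" using mK by (intro sets.countable_UN) blast
    qed
    also have "\<dots> \<le> (\<Sum>i. measure M (U i - K i))"
      using mK by (intro finite_measure_subadditive_countably sm) blast
    also have "\<dots> \<le> e/2"
      using suminf_le[OF less_imp_le[OF KU(5)] sm sums_summable[OF ss]] sums_unique[OF ss] by simp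
    also have "\<dots> < e" using Union by simp
    finally have lt: "measure M (\<Inter>n. R n) < e" .
    have "(\<lambda>n. measure M (R n)) \<longlonglongrightarrow> measure M (\<Inter>n. R n)"
      by (rule finite_Lim_measure_decseq[OF mR dec])
    then have "\<forall>\<^sub>F n in sequentially. measure M (R n) < e" using lt by (rule order_tendstoD(2))
    then obtain n where n: "measure M (R n) < e" by (meson eventually_sequentially order_refl)
    have "closed (\<Union>i\<le>n. K i)" using KU(1) by (intro closed_UN) simp_all
    moreover have "(\<Union>i\<le>n. K i) \<subseteq> \<Union>(range a)" "\<Union>(range a) \<subseteq> V" unfolding V_def using KU(3,4) by blast+
    ultimately show ?case
      using oV n unfolding R_def by (intro exI[of _ "\<Union>i\<le>n. K i"] exI[of _ V]) simp
  qed
qed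

lemma closed_inner_approx:
  fixes M :: "'a::metric_space measure"
  assumes M: "finite_measure M" and sets: "sets M = sets borel" and B: "B \<in> sets borel" and e: "0 < e"
  shows "\<exists>K. closed K \<and> K \<subseteq> B \<and> measure M B - e < measure M K"
proof -
  interpret finite_measure M by (rule M)
  obtain K U where KU: "closed K" "open U" "K \<subseteq> B" "B \<subseteq> U" "measure M (U - K) < e"
    using closed_open_approx[OF assms] by blast
  have "measure M B - measure M K = measure M (B - K)"
    using KU B sets by (intro finite_measure_Diff[symmetric]) auto
  also have "\<dots> \<le> measure M (U - K)" using KU B sets by (intro finite_measure_mono) auto
  finally show ?thesis using KU by (intro exI[of _ K]) auto
qed

lemma Urysohn_metric_space:
  fixes S T :: "'a::metric_space set"
  assumes "closed S" "closed T" "S \<inter> T = {}"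
  shows "\<exists>f::'a \<Rightarrow> real. continuous_on UNIV f \<and> (\<forall>x. 0 \<le> f x \<and> f x \<le> 1) \<and>
           (\<forall>x\<in>S. f x = 1) \<and> (\<forall>x\<in>T. f x = 0)"
proof -
  have "normal_space (euclidean :: 'a topology)"
    by (intro metrizable_imp_normal_space metrizable_space_euclidean)
  then obtain f where f: "continuous_map euclidean (subtopology euclideanreal {0..1}) f"
      "f ` T \<subseteq> {0}" "f ` S \<subseteq> {1::real}"
  proof (rule Urysohn_lemma[of euclidean T S 0 1])
    show "closedin euclidean T" "closedin euclidean S" "disjnt T S"
      using assms by (auto simp: disjnt_def)
  qed simp_all
  have "continuous_on UNIV f"
    using f(1) by (metis continuous_map_in_subtopology continuous_map_iff_continuous2)
  moreover have "f x \<in> {0..1}" for x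
    using continuous_map_image_subset_topspace[OF f(1)] by (simp add: image_subset_iff)
  ultimately show ?thesis using f(2,3) by (intro exI[of _ f]) (simp add: image_subset_iff)
qed

text \<open>
  Urysohn functions \<open>g\<^sub>i\<close> for the \<open>K i\<close>, vanishing on the other \<open>K j\<close>, may overlap.  The positive part
  of \<open>g\<^sub>i\<close> minus the sum of the others cures this: if it is positive for both \<open>i\<close> and \<open>j\<close>, then
  \<open>g\<^sub>i > g\<^sub>j > g\<^sub>i\<close>.
\<close>

lemma exists_disjoint_bump_functions:
  fixes K V :: "'i \<Rightarrow> 'a::metric_space set"
  assumes I: "finite I" and K: "\<And>i. i \<in> I \<Longrightarrow> closed (K i)" and V: "\<And>i. i \<in> I \<Longrightarrow> open (V i)"
    and KV: "\<And>i. i \<in> I \<Longrightarrow> K i \<subseteq> V i"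
    and disj: "\<And>i j. i \<in> I \<Longrightarrow> j \<in> I \<Longrightarrow> i \<noteq> j \<Longrightarrow> K i \<inter> K j = {}"
  obtains f :: "'i \<Rightarrow> 'a \<Rightarrow> real" where
    "\<And>i. i \<in> I \<Longrightarrow> continuous_on UNIV (f i)"
    "\<And>i x. i \<in> I \<Longrightarrow> 0 \<le> f i x" "\<And>i x. i \<in> I \<Longrightarrow> f i x \<le> 1"
    "\<And>i x. i \<in> I \<Longrightarrow> x \<in> K i \<Longrightarrow> f i x = 1"
    "\<And>i x. i \<in> I \<Longrightarrow> 0 < f i x \<Longrightarrow> x \<in> V i"
    "\<And>i j x. i \<in> I \<Longrightarrow> j \<in> I \<Longrightarrow> 0 < f i x \<Longrightarrow> 0 < f j x \<Longrightarrow> i = j"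
proof -
  let ?Z = "\<lambda>i. - V i \<union> (\<Union>j\<in>I - {i}. K j)"
  have "\<forall>i\<in>I. \<exists>g::'a \<Rightarrow> real. continuous_on UNIV g \<and> (\<forall>x. 0 \<le> g x \<and> g x \<le> 1) \<and>
           (\<forall>x\<in>K i. g x = 1) \<and> (\<forall>x\<in>?Z i. g x = 0)"
  proof
    fix i assume i: "i \<in> I"
    show "\<exists>g::'a \<Rightarrow> real. continuous_on UNIV g \<and> (\<forall>x. 0 \<le> g x \<and> g x \<le> 1) \<and>
           (\<forall>x\<in>K i. g x = 1) \<and> (\<forall>x\<in>?Z i. g x = 0)"
    proof (rule Urysohn_metric_space)
      show "closed (K i)" using K i by simp
      show "closed (?Z i)" using V K I i by (intro closed_Un closed_UN closed_Compl) auto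
      show "K i \<inter> ?Z i = {}" using KV[OF i] disj[OF i] by fastforce
    qed
  qed
  from bchoice[OF this] obtain g :: "'i \<Rightarrow> 'a \<Rightarrow> real" where
    g0: "\<forall>i\<in>I. continuous_on UNIV (g i) \<and> (\<forall>x. 0 \<le> g i x \<and> g i x \<le> 1) \<and>
           (\<forall>x\<in>K i. g i x = 1) \<and> (\<forall>x\<in>?Z i. g i x = 0)" ..
  then have
    g: "i \<in> I \<Longrightarrow> continuous_on UNIV (g i)" "i \<in> I \<Longrightarrow> 0 \<le> g i x"
      "i \<in> I \<Longrightarrow> g i x \<le> 1" "i \<in> I \<Longrightarrow> x \<in> K i \<Longrightarrow> g i x = 1"
      "i \<in> I \<Longrightarrow> x \<in> ?Z i \<Longrightarrow> g i x = 0"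
    for i x by simp_all
  define f where "f i x = max 0 (g i x - (\<Sum>j\<in>I - {i}. g j x))" for i x
  have pos: "g i x > (\<Sum>j\<in>I - {i}. g j x)" if "0 < f i x" for i x
    using that by (auto simp: f_def)
  have le: "g j x \<le> (\<Sum>j\<in>I - {i}. g j x)" if "i \<in> I" "j \<in> I" "i \<noteq> j" for i j x
    using that g(2) I by (intro member_le_sum) auto
  have nn: "0 \<le> (\<Sum>j\<in>I - {i}. g j x)" for i x using g(2) by (intro sum_nonneg) auto
  show ?thesis
  proof (rule that[of f])
    fix i assume i: "i \<in> I"
    show "continuous_on UNIV (f i)" unfolding f_def using g(1) i by (intro continuous_intros) auto
    fix x
    show "0 \<le> f i x" by (simp add: f_def)
    show "f i x \<le> 1" using nn[of x i] g(3)[OF i, of x] by (simp add: f_def)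
    show "f i x = 1" if x: "x \<in> K i"
    proof -
      have "(\<Sum>j\<in>I - {i}. g j x) = 0" using x i g(5) by (intro sum.neutral) auto
      then show ?thesis using g(4)[OF i x] by (simp add: f_def)
    qed
    show "x \<in> V i" if "0 < f i x"
    proof (rule ccontr)
      assume "x \<notin> V i"
      then have "g i x = 0" using g(5)[OF i] by simp
      then show False using pos[OF that] nn[of x i] by simp
    qed
    show "i = j" if "j \<in> I" "0 < f i x" "0 < f j x" for j
      using pos[OF that(2)] pos[OF that(3)] le[of i j x] le[of j i x] that i by fastforce
  qed
qed

section \<open>Entropy of partitions and covers\<close>

lemma neg_mult_ln_bounds:
  fixes x :: real
  assumes "0 \<le> x" "x \<le> 1"
  shows "0 \<le> - x * ln x" "- x * ln x \<le> 1"
proof -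
  show "0 \<le> - x * ln x"
    using assms by (cases "x = 0") (auto simp: mult_nonneg_nonpos)
  show "- x * ln x \<le> 1"
  proof (cases "x = 0")
    case False
    then have x: "0 < x" using assms by simp
    then have "ln (1 / x) \<le> 1 / x - 1" by (intro ln_le_minus_one) simp
    then have "x * ln (1 / x) \<le> x * (1 / x - 1)" using x by (intro mult_left_mono) auto
    then show ?thesis using x by (simp add: ln_div algebra_simps)
  qed simp
qed

lemma continuous_on_neg_mult_ln: "continuous_on {0..1} (\<lambda>x::real. - x * ln x)"
  unfolding continuous_on_def
proof
  fix x :: real assume x: "x \<in> {0..1}"
  show "((\<lambda>x. - x * ln x) \<longlongrightarrow> - x * ln x) (at x within {0..1})"
  proof (cases "x = 0")
    case True
    have "((\<lambda>x::real. - x * ln x) \<longlongrightarrow> 0) (at_right 0)" by real_asymp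
    then have "((\<lambda>x::real. - x * ln x) \<longlongrightarrow> 0) (at 0 within {0..1})"
      by (simp add: at_within_Icc_at_right)
    then show ?thesis using True by simp
  next
    case False
    then show ?thesis by (intro tendsto_intros) auto
  qed
qed

lemma entropy_term_nonneg:
  assumes "prob_space \<mu>" shows "0 \<le> - measure \<mu> A * ln (measure \<mu> A)"
  using assms by (intro neg_mult_ln_bounds) (auto simp: prob_space.prob_le_1)

lemma entropy_partition_nonneg:
  assumes "prob_space \<mu>" shows "0 \<le> entropy_partition \<mu> \<alpha>"
  unfolding entropy_partition_def using entropy_term_nonneg[OF assms] by (intro sum_nonneg) simp

lemma entropy_partition_le_card:
  assumes "prob_space \<mu>" shows "entropy_partition \<mu> \<alpha> \<le> card \<alpha>"
proof -
  have "(\<Sum>A\<in>\<alpha>. - measure \<mu> A * ln (measure \<mu> A)) \<le> (\<Sum>A\<in>\<alpha>. 1)"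
    using assms by (intro sum_mono neg_mult_ln_bounds) (auto simp: prob_space.prob_le_1)
  then show ?thesis by (simp add: entropy_partition_def)
qed

lemma entropy_partition_image_le:
  assumes "prob_space \<mu>" "finite I"
  shows "entropy_partition \<mu> (f ` I) \<le> (\<Sum>i\<in>I. - measure \<mu> (f i) * ln (measure \<mu> (f i)))"
  unfolding entropy_partition_def
  using sum_image_le[of I "\<lambda>A. - measure \<mu> A * ln (measure \<mu> A)" f]
    assms entropy_term_nonneg[OF assms(1)] by (simp add: comp_def)

lemma entropy_partition_Un_le:
  assumes "prob_space \<mu>" "finite \<alpha>" "finite \<beta>"
  shows "entropy_partition \<mu> (\<alpha> \<union> \<beta>) \<le> entropy_partition \<mu> \<alpha> + entropy_partition \<mu> \<beta>"
proof -
  have "entropy_partition \<mu> (\<alpha> \<union> \<beta>) + entropy_partition \<mu> (\<alpha> \<inter> \<beta>)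
      = entropy_partition \<mu> \<alpha> + entropy_partition \<mu> \<beta>"
    unfolding entropy_partition_def using assms by (intro sum.union_inter)
  then show ?thesis using entropy_partition_nonneg[OF assms(1), of "\<alpha> \<inter> \<beta>"] by simp
qed

lemma sum_measure_Int_partition:
  assumes "finite_measure \<mu>" "sets \<mu> = sets borel" "borel_partition \<beta>" "A \<in> sets borel"
  shows "(\<Sum>B\<in>\<beta>. measure \<mu> (A \<inter> B)) = measure \<mu> A"
proof -
  have \<beta>: "finite \<beta>" "\<And>B. B \<in> \<beta> \<Longrightarrow> B \<in> sets borel" "\<Union>\<beta> = UNIV"
      "\<And>B C. B \<in> \<beta> \<Longrightarrow> C \<in> \<beta> \<Longrightarrow> B \<noteq> C \<Longrightarrow> B \<inter> C = {}"
    using assms(3) by (auto simp: borel_partition_def borel_cover_def disjoint_def)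
  have "measure \<mu> (\<Union>B\<in>\<beta>. A \<inter> B) = (\<Sum>B\<in>\<beta>. measure \<mu> (A \<inter> B))"
  proof (rule finite_measure.finite_measure_finite_Union[OF assms(1) \<beta>(1)])
    show "(\<inter>) A ` \<beta> \<subseteq> sets \<mu>" using \<beta>(2) assms by auto
    show "disjoint_family_on ((\<inter>) A) \<beta>"
      using \<beta>(4) unfolding disjoint_family_on_def by blast
  qed
  moreover have "(\<Union>B\<in>\<beta>. A \<inter> B) = A" using \<beta>(3) by blast
  ultimately show ?thesis by simp
qed

text \<open>
  The inequality \<open>ln x \<le> x - 1\<close> at \<open>x = a b / p\<close>; summed over a joint distribution it yields the
  subadditivity of entropy, since the terms \<open>a b - p\<close> add up to zero.
\<close>

lemma entropy_product_term_le:
  fixes p a b :: real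
  assumes "0 \<le> p" "p \<le> a" "p \<le> b"
  shows "- p * ln p \<le> (- p * ln a) + (- p * ln b) + (a * b - p)"
proof (cases "p = 0")
  case False
  then have pos: "0 < p" "0 < a" "0 < b" using assms by auto
  then have "ln (a * b / p) \<le> a * b / p - 1" by (intro ln_le_minus_one) simp
  then have "p * ln (a * b / p) \<le> p * (a * b / p - 1)" using pos by (intro mult_left_mono) auto
  then have "p * ln (a * b / p) \<le> a * b - p" using pos by (simp add: algebra_simps)
  then show ?thesis using pos by (simp add: ln_div ln_mult algebra_simps)
qed (use assms in simp)

lemma entropy_partition_join_le:
  assumes \<mu>: "prob_space \<mu>" "sets \<mu> = sets borel" and \<alpha>: "borel_partition \<alpha>" and \<beta>: "borel_partition \<beta>"
  shows "entropy_partition \<mu> ((\<lambda>(A, B). A \<inter> B) ` (\<alpha> \<times> \<beta>))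
           \<le> entropy_partition \<mu> \<alpha> + entropy_partition \<mu> \<beta>"
proof -
  interpret prob_space \<mu> by (rule \<mu>)
  let ?m = "measure \<mu>"
  have fin: "finite \<alpha>" "finite \<beta>" using \<alpha> \<beta> by (auto simp: borel_partition_def borel_cover_def)
  have meas: "A \<in> sets borel" if "A \<in> \<alpha> \<union> \<beta>" for A
    using that \<alpha> \<beta> by (auto simp: borel_partition_def borel_cover_def)
  have row: "(\<Sum>B\<in>\<beta>. ?m (A \<inter> B)) = ?m A" if "A \<in> \<alpha>" for A
    using sum_measure_Int_partition[OF _ \<mu>(2) \<beta>] meas that finite_measure_axioms by simp
  have col: "(\<Sum>A\<in>\<alpha>. ?m (A \<inter> B)) = ?m B" if "B \<in> \<beta>" for B
    using sum_measure_Int_partition[OF _ \<mu>(2) \<alpha>, of B] meas that finite_measure_axioms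
    by (simp add: Int_commute)
  have sp: "space \<mu> = UNIV" using sets_eq_imp_space_eq[OF \<mu>(2)] by simp
  have one: "?m UNIV = 1" using prob_space sp by simp
  have tot\<alpha>: "(\<Sum>A\<in>\<alpha>. ?m A) = 1" and tot\<beta>: "(\<Sum>B\<in>\<beta>. ?m B) = 1"
    using sum_measure_Int_partition[OF finite_measure_axioms \<mu>(2) \<alpha>, of UNIV]
      sum_measure_Int_partition[OF finite_measure_axioms \<mu>(2) \<beta>, of UNIV] one by simp_all
  have "entropy_partition \<mu> ((\<lambda>(A, B). A \<inter> B) ` (\<alpha> \<times> \<beta>))
      \<le> (\<Sum>(A, B)\<in>\<alpha> \<times> \<beta>. - ?m (A \<inter> B) * ln (?m (A \<inter> B)))"
    using entropy_partition_image_le[OF \<mu>(1), of "\<alpha> \<times> \<beta>" "\<lambda>(A, B). A \<inter> B"] fin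
    by (simp add: case_prod_unfold)
  also have "\<dots> = (\<Sum>A\<in>\<alpha>. \<Sum>B\<in>\<beta>. - ?m (A \<inter> B) * ln (?m (A \<inter> B)))"
    by (rule sum.cartesian_product[symmetric])
  also have "\<dots> \<le> (\<Sum>A\<in>\<alpha>. \<Sum>B\<in>\<beta>. (- ?m (A \<inter> B) * ln (?m A)) + (- ?m (A \<inter> B) * ln (?m B))
                      + (?m A * ?m B - ?m (A \<inter> B)))"
    using meas \<mu>(2) by (intro sum_mono entropy_product_term_le finite_measure_mono) auto
  also have "\<dots> = (\<Sum>A\<in>\<alpha>. \<Sum>B\<in>\<beta>. - ?m (A \<inter> B) * ln (?m A))
                + (\<Sum>A\<in>\<alpha>. \<Sum>B\<in>\<beta>. - ?m (A \<inter> B) * ln (?m B))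
                + ((\<Sum>A\<in>\<alpha>. \<Sum>B\<in>\<beta>. ?m A * ?m B) - (\<Sum>A\<in>\<alpha>. \<Sum>B\<in>\<beta>. ?m (A \<inter> B)))"
    by (simp only: sum.distrib sum_subtractf)
  also have "(\<Sum>A\<in>\<alpha>. \<Sum>B\<in>\<beta>. - ?m (A \<inter> B) * ln (?m A)) = entropy_partition \<mu> \<alpha>"
    unfolding entropy_partition_def
  proof (intro sum.cong refl)
    fix A assume A: "A \<in> \<alpha>"
    have "(\<Sum>B\<in>\<beta>. - ?m (A \<inter> B) * ln (?m A)) = - (\<Sum>B\<in>\<beta>. ?m (A \<inter> B)) * ln (?m A)"
      by (simp only: sum_negf[symmetric] sum_distrib_right)
    then show "(\<Sum>B\<in>\<beta>. - ?m (A \<inter> B) * ln (?m A)) = - ?m A * ln (?m A)"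
      by (simp only: row[OF A])
  qed
  also have "(\<Sum>A\<in>\<alpha>. \<Sum>B\<in>\<beta>. - ?m (A \<inter> B) * ln (?m B)) = entropy_partition \<mu> \<beta>"
    unfolding entropy_partition_def
  proof (subst sum.swap, intro sum.cong refl)
    fix B assume B: "B \<in> \<beta>"
    have "(\<Sum>A\<in>\<alpha>. - ?m (A \<inter> B) * ln (?m B)) = - (\<Sum>A\<in>\<alpha>. ?m (A \<inter> B)) * ln (?m B)"
      by (simp only: sum_negf[symmetric] sum_distrib_right)
    then show "(\<Sum>A\<in>\<alpha>. - ?m (A \<inter> B) * ln (?m B)) = - ?m B * ln (?m B)"
      by (simp only: col[OF B])
  qed
  also have "(\<Sum>A\<in>\<alpha>. \<Sum>B\<in>\<beta>. ?m A * ?m B) = 1"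
    by (simp add: sum_distrib_left[symmetric] tot\<alpha> tot\<beta>)
  also have "(\<Sum>A\<in>\<alpha>. \<Sum>B\<in>\<beta>. ?m (A \<inter> B)) = 1"
    using row tot\<alpha> by simp
  finally show ?thesis by simp
qed

lemma borel_partition_join:
  assumes "borel_partition \<alpha>" "borel_partition \<beta>"
  shows "borel_partition ((\<lambda>(A, B). A \<inter> B) ` (\<alpha> \<times> \<beta>))"
proof -
  have \<alpha>: "finite \<alpha>" "\<alpha> \<subseteq> sets borel" "\<Union>\<alpha> = UNIV" "\<And>A B. A \<in> \<alpha> \<Longrightarrow> B \<in> \<alpha> \<Longrightarrow> A \<noteq> B \<Longrightarrow> A \<inter> B = {}"
    and \<beta>: "finite \<beta>" "\<beta> \<subseteq> sets borel" "\<Union>\<beta> = UNIV" "\<And>A B. A \<in> \<beta> \<Longrightarrow> B \<in> \<beta> \<Longrightarrow> A \<noteq> B \<Longrightarrow> A \<inter> B = {}"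
    using assms by (auto simp: borel_partition_def borel_cover_def disjoint_def)
  have "(\<lambda>(A, B). A \<inter> B) ` (\<alpha> \<times> \<beta>) \<subseteq> sets borel" using \<alpha>(2) \<beta>(2) by auto
  moreover have "\<Union>((\<lambda>(A, B). A \<inter> B) ` (\<alpha> \<times> \<beta>)) = UNIV"
  proof -
    have "x \<in> \<Union>((\<lambda>(A, B). A \<inter> B) ` (\<alpha> \<times> \<beta>))" for x
    proof -
      obtain A B where "A \<in> \<alpha>" "x \<in> A" "B \<in> \<beta>" "x \<in> B" using \<alpha>(3) \<beta>(3) by blast
      then show ?thesis by force
    qed
    then show ?thesis by blast
  qed
  moreover have "disjoint ((\<lambda>(A, B). A \<inter> B) ` (\<alpha> \<times> \<beta>))"
  proof (rule disjointI, clarify)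
    fix A B C D assume "A \<in> \<alpha>" "B \<in> \<beta>" "C \<in> \<alpha>" "D \<in> \<beta>" "A \<inter> B \<noteq> C \<inter> D"
    then have "A \<inter> C = {} \<or> B \<inter> D = {}" using \<alpha>(4) \<beta>(4) by blast
    then show "A \<inter> B \<inter> (C \<inter> D) = {}" by blast
  qed
  ultimately show ?thesis using \<alpha>(1) \<beta>(1) by (simp add: borel_partition_def borel_cover_def)
qed

lemma borel_partition_vimage:
  assumes \<alpha>: "borel_partition \<alpha>" and f: "f \<in> borel_measurable borel"
  shows "borel_partition ((\<lambda>A. f -` A) ` \<alpha>)"
proof -
  have a: "finite \<alpha>" "\<alpha> \<subseteq> sets borel" "\<Union>\<alpha> = UNIV" "\<And>A B. A \<in> \<alpha> \<Longrightarrow> B \<in> \<alpha> \<Longrightarrow> A \<noteq> B \<Longrightarrow> A \<inter> B = {}"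
    using assms by (auto simp: borel_partition_def borel_cover_def disjoint_def)
  have "(\<lambda>A. f -` A) ` \<alpha> \<subseteq> sets borel" using a(2) measurable_sets[OF f] by auto
  moreover have "\<Union>((\<lambda>A. f -` A) ` \<alpha>) = UNIV" using a(3) by (metis vimage_UNIV vimage_Union)
  moreover have "disjoint ((\<lambda>A. f -` A) ` \<alpha>)"
  proof (rule disjointI, clarify)
    fix A B assume "A \<in> \<alpha>" "B \<in> \<alpha>" "f -` A \<noteq> f -` B"
    then have "A \<inter> B = {}" using a(4) by blast
    then show "f -` A \<inter> f -` B = {}" by blast
  qed
  ultimately show ?thesis using a(1) by (simp add: borel_partition_def borel_cover_def)
qed

text \<open>
  Two points are put into the same cell when they lie in the same members of the cover.
\<close>

lemma exists_finer_partition: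
  assumes "borel_cover \<U>"
  obtains \<alpha> where "borel_partition \<alpha>" "finer \<alpha> \<U>"
proof -
  have U: "finite \<U>" "\<And>V. V \<in> \<U> \<Longrightarrow> V \<in> sets borel" "\<Union>\<U> = UNIV"
    using assms by (auto simp: borel_cover_def)
  define cell where "cell W = {x. {V \<in> \<U>. x \<in> V} = W}" for W
  have cell: "cell W = (\<Inter>V\<in>W. V) \<inter> (UNIV - \<Union>(\<U> - W))" if "W \<subseteq> \<U>" for W
    using that unfolding cell_def by blast
  have "cell W \<in> sets borel" if W: "W \<subseteq> \<U>" for W
  proof (cases "W = {}")
    case True
    then show ?thesis unfolding cell[OF W] using U by auto
  next
    case False
    then show ?thesis unfolding cell[OF W]
      using U W finite_subset[OF W] by (intro sets.Int sets.finite_INT sets.Diff sets.finite_Union) auto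
  qed
  then have "borel_partition (cell ` Pow \<U>)"
    unfolding borel_partition_def borel_cover_def disjoint_def using U by (auto simp: cell_def)
  moreover have "finer (cell ` Pow \<U>) \<U>"
    unfolding finer_def
  proof
    fix A assume "A \<in> cell ` Pow \<U>"
    then obtain W where W: "W \<subseteq> \<U>" "A = cell W" by blast
    show "\<exists>V\<in>\<U>. A \<subseteq> V"
    proof (cases "W = {}")
      case True
      then have "A = {}" using U(3) W by (auto simp: cell_def)
      moreover have "\<U> \<noteq> {}" using U(3) by auto
      ultimately show ?thesis by blast
    next
      case False
      then show ?thesis using W by (auto simp: cell_def)
    qed
  qed
  ultimately show ?thesis by (rule that)
qed

lemma entropy_cover_le:
  assumes "prob_space \<mu>" "borel_partition \<alpha>" "finer \<alpha> \<U>"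
  shows "entropy_cover \<mu> \<U> \<le> entropy_partition \<mu> \<alpha>"
  unfolding entropy_cover_def
proof (rule cInf_lower)
  show "bdd_below {entropy_partition \<mu> \<alpha> | \<alpha>. borel_partition \<alpha> \<and> finer \<alpha> \<U>}"
    by (rule bdd_belowI[of _ 0]) (use entropy_partition_nonneg[OF assms(1)] in auto)
qed (use assms in blast)

lemma entropy_cover_lessD:
  assumes "borel_cover \<U>" "entropy_cover \<mu> \<U> < a"
  obtains \<alpha> where "borel_partition \<alpha>" "finer \<alpha> \<U>" "entropy_partition \<mu> \<alpha> < a"
proof -
  have "{entropy_partition \<mu> \<alpha> | \<alpha>. borel_partition \<alpha> \<and> finer \<alpha> \<U>} \<noteq> {}"
    using exists_finer_partition[OF assms(1)] by blast
  from cInf_lessD[OF this] show ?thesis using assms(2) that unfolding entropy_cover_def by blast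
qed

lemma entropy_cover_nonneg:
  assumes "prob_space \<mu>" "borel_cover \<U>"
  shows "0 \<le> entropy_cover \<mu> \<U>"
  using entropy_cover_lessD[OF assms(2)] entropy_partition_nonneg[OF assms(1)] by (meson not_le)

section \<open>Upper semicontinuity of the entropy of an open cover\<close>

lemma openin_weak_star_integral_greater:
  fixes f :: "'x::metric_space \<Rightarrow> real"
  assumes "continuous_on UNIV f"
  shows "openin (weak_star_topology S) {\<nu> \<in> S. c < (\<integral>x. f x \<partial>\<nu>)}"
  unfolding weak_star_topology_def
proof (rule topology_generated_by_Basis, rule CollectI, intro exI conjI)
  show "{\<nu> \<in> S. c < (\<integral>x. f x \<partial>\<nu>)} = {\<nu> \<in> S. (\<integral>x. f x \<partial>\<nu>) \<in> {c<..}}" by simp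
qed (use assms in auto)

text \<open>
  Let \<open>\<alpha>\<close> be a partition finer than \<open>\<U>\<close> whose entropy for \<open>\<mu>\<close> is below \<open>a\<close>; its cells need not be
  continuity sets of \<open>\<mu>\<close>.  Approximate each cell from inside by a closed set and enlarge these closed
  sets to disjoint open sets \<open>Q A\<close>, inside members of \<open>\<U>\<close>, that carry bump functions.  The rest \<open>R\<close> is
  cut along \<open>\<alpha>\<close>, which gives a new partition finer than \<open>\<U>\<close>.

  The integrals of the bump functions bound \<open>\<nu>(Q A)\<close> from below by \<open>\<mu>(A) - t\<close> for \<open>\<nu>\<close> near \<open>\<mu>\<close>.  Since
  the total mass is one, these lower bounds also force upper bounds on \<open>\<nu>(Q A)\<close> and on \<open>\<nu>(R)\<close>, so
  the entropy of the new partition for \<open>\<nu>\<close> is close to that of \<open>\<alpha>\<close> for \<open>\<mu>\<close>.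
\<close>

lemma upper_semicontinuous_entropy_cover:
  fixes \<U> :: "'x::metric_space set set"
  assumes S: "\<And>\<nu>. \<nu> \<in> S \<Longrightarrow> prob_space \<nu> \<and> sets \<nu> = sets borel"
    and fin: "finite \<U>" and op: "\<And>V. V \<in> \<U> \<Longrightarrow> open V" and cov: "\<Union>\<U> = UNIV"
  shows "upper_semicontinuous (weak_star_topology S) (\<lambda>\<nu>. entropy_cover \<nu> \<U>)"
  unfolding upper_semicontinuous_def topspace_weak_star_topology
proof (intro allI)
  fix a :: real
  have bc: "borel_cover \<U>" using fin op cov by (auto simp: borel_cover_def)
  show "openin (weak_star_topology S) {\<nu> \<in> S. entropy_cover \<nu> \<U> < a}"
  proof (subst openin_subopen, rule ballI)
    fix \<mu> assume "\<mu> \<in> {\<nu> \<in> S. entropy_cover \<nu> \<U> < a}"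
    then have \<mu>S: "\<mu> \<in> S" and lt: "entropy_cover \<mu> \<U> < a" by auto
    interpret \<mu>: prob_space \<mu> using S \<mu>S by blast
    have s\<mu>: "sets \<mu> = sets borel" using S \<mu>S by blast
    obtain \<alpha> where \<alpha>: "borel_partition \<alpha>" "finer \<alpha> \<U>" "entropy_partition \<mu> \<alpha> < a"
      using entropy_cover_lessD[OF bc lt] by blast
    have f\<alpha>: "finite \<alpha>" and m\<alpha>: "\<And>A. A \<in> \<alpha> \<Longrightarrow> A \<in> sets borel" and U\<alpha>: "\<Union>\<alpha> = UNIV"
      and d\<alpha>: "\<And>A B. A \<in> \<alpha> \<Longrightarrow> B \<in> \<alpha> \<Longrightarrow> A \<noteq> B \<Longrightarrow> A \<inter> B = {}"
      using \<alpha>(1) by (auto simp: borel_partition_def borel_cover_def disjoint_def)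
    have tot: "(\<Sum>A\<in>\<alpha>. measure \<nu> A) = 1" if "\<nu> \<in> S" for \<nu>
    proof -
      interpret \<nu>: prob_space \<nu> using S that by blast
      have s\<nu>: "sets \<nu> = sets borel" using S that by blast
      have "space \<nu> = UNIV" using sets_eq_imp_space_eq[OF s\<nu>] by simp
      then have "measure \<nu> UNIV = 1" using \<nu>.prob_space by simp
      then show ?thesis
        using sum_measure_Int_partition[OF \<nu>.finite_measure_axioms s\<nu> \<alpha>(1), of UNIV] by simp
    qed
    define \<eta> :: "real \<Rightarrow> real" where "\<eta> x = - x * ln x" for x
    define m where "m = real (card \<alpha>)"
    have m0: "m \<ge> 0" by (simp add: m_def)
    \<comment> \<open>the new partition has up to \<open>2 m\<close> cells, each contributing an error of at most \<open>e\<close>\<close>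
    define e where "e = (a - entropy_partition \<mu> \<alpha>) / (2 * m + 1)"
    have e: "e > 0" unfolding e_def using \<alpha>(3) m0 by simp
    have "uniformly_continuous_on {0..1} \<eta>"
      unfolding \<eta>_def using continuous_on_neg_mult_ln by (intro compact_uniformly_continuous) auto
    then obtain d where d: "d > 0"
      "\<And>x y. x \<in> {0..1} \<Longrightarrow> y \<in> {0..1} \<Longrightarrow> \<bar>y - x\<bar> < d \<Longrightarrow> \<bar>\<eta> y - \<eta> x\<bar> < e"
      unfolding uniformly_continuous_on_def dist_real_def using e by metis
    \<comment> \<open>masses can deviate by \<open>m t\<close>, the accumulated loss of all \<open>m\<close> cells\<close>
    define t where "t = d / (m + 1)"
    have t: "t > 0" "m * t < d" unfolding t_def using d m0 by (auto simp: field_simps)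
    have "\<forall>A\<in>\<alpha>. \<exists>K. closed K \<and> K \<subseteq> A \<and> measure \<mu> A - t < measure \<mu> K"
      using closed_inner_approx[OF \<mu>.finite_measure_axioms s\<mu> m\<alpha> t(1)] by blast
    from bchoice[OF this] obtain K where
      K: "\<forall>A\<in>\<alpha>. closed (K A) \<and> K A \<subseteq> A \<and> measure \<mu> A - t < measure \<mu> (K A)" ..
    have "\<forall>A\<in>\<alpha>. \<exists>V. V \<in> \<U> \<and> A \<subseteq> V" using \<alpha>(2) unfolding finer_def by blast
    from bchoice[OF this] obtain V where V: "\<forall>A\<in>\<alpha>. V A \<in> \<U> \<and> A \<subseteq> V A" ..
    obtain f :: "'x set \<Rightarrow> 'x \<Rightarrow> real" where
      f: "\<And>A. A \<in> \<alpha> \<Longrightarrow> continuous_on UNIV (f A)"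
      "\<And>A x. A \<in> \<alpha> \<Longrightarrow> 0 \<le> f A x" "\<And>A x. A \<in> \<alpha> \<Longrightarrow> f A x \<le> 1"
      "\<And>A x. A \<in> \<alpha> \<Longrightarrow> x \<in> K A \<Longrightarrow> f A x = 1"
      "\<And>A x. A \<in> \<alpha> \<Longrightarrow> 0 < f A x \<Longrightarrow> x \<in> V A"
      "\<And>A B x. A \<in> \<alpha> \<Longrightarrow> B \<in> \<alpha> \<Longrightarrow> 0 < f A x \<Longrightarrow> 0 < f B x \<Longrightarrow> A = B"
    proof (rule exists_disjoint_bump_functions[OF f\<alpha>, of K V])
      show "closed (K A)" if "A \<in> \<alpha>" for A using K that by blast
      show "open (V A)" if "A \<in> \<alpha>" for A using V op that by blast
      show "K A \<subseteq> V A" if "A \<in> \<alpha>" for A using K V that by blast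
      show "K A \<inter> K B = {}" if "A \<in> \<alpha>" "B \<in> \<alpha>" "A \<noteq> B" for A B
        using K d\<alpha>[OF that] that by blast
    qed blast
    define Q where "Q A = {x. 0 < f A x}" for A
    define R where "R = UNIV - (\<Union>A\<in>\<alpha>. Q A)"
    have oO: "open (Q A)" if "A \<in> \<alpha>" for A
      unfolding Q_def using f(1)[OF that] by (intro open_Collect_less continuous_intros) auto
    have mO: "Q A \<in> sets borel" if "A \<in> \<alpha>" for A using oO[OF that] by simp
    have mR: "R \<in> sets borel"
      unfolding R_def using mO f\<alpha> by (intro sets.Diff sets.finite_UN) auto
    define \<beta> where "\<beta> = Q ` \<alpha> \<union> (\<lambda>A. R \<inter> A) ` \<alpha>"
    have "disjoint \<beta>"
    proof (rule disjointI)
      fix X Y assume X: "X \<in> \<beta>" and Y: "Y \<in> \<beta>" and ne: "X \<noteq> Y"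
      have OO: "Q A \<inter> Q B = {}" if "A \<in> \<alpha>" "B \<in> \<alpha>" "Q A \<noteq> Q B" for A B
        using that f(6)[of A B] unfolding Q_def by blast
      have OR: "Q A \<inter> R = {}" if "A \<in> \<alpha>" for A using that unfolding R_def by blast
      have RR: "(R \<inter> A) \<inter> (R \<inter> B) = {}" if "A \<in> \<alpha>" "B \<in> \<alpha>" "R \<inter> A \<noteq> R \<inter> B" for A B
        using that d\<alpha>[of A B] by blast
      from X Y show "X \<inter> Y = {}"
        unfolding \<beta>_def
      proof (elim UnE imageE)
        fix A B assume "X = Q A" "A \<in> \<alpha>" "Y = Q B" "B \<in> \<alpha>"
        then show ?thesis using OO ne by simp
      next
        fix A B assume "X = Q A" "A \<in> \<alpha>" "Y = R \<inter> B" "B \<in> \<alpha>"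
        then show ?thesis using OR[of A] by blast
      next
        fix A B assume "X = R \<inter> A" "A \<in> \<alpha>" "Y = Q B" "B \<in> \<alpha>"
        then show ?thesis using OR[of B] by blast
      next
        fix A B assume "X = R \<inter> A" "A \<in> \<alpha>" "Y = R \<inter> B" "B \<in> \<alpha>"
        then show ?thesis using RR ne by simp
      qed
    qed
    moreover have "\<Union>\<beta> = UNIV"
    proof -
      have "x \<in> \<Union>\<beta>" for x
      proof (cases "x \<in> R")
        case True
        moreover obtain A where "A \<in> \<alpha>" "x \<in> A" using U\<alpha> by blast
        ultimately show ?thesis unfolding \<beta>_def by blast
      next
        case False
        then show ?thesis unfolding \<beta>_def R_def by blast
      qed
      then show ?thesis by blast
    qed
    moreover have "\<beta> \<subseteq> sets borel" unfolding \<beta>_def using mO mR m\<alpha> by blast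
    moreover have "finite \<beta>" unfolding \<beta>_def using f\<alpha> by simp
    ultimately have p\<beta>: "borel_partition \<beta>" by (simp add: borel_partition_def borel_cover_def)
    have fine\<beta>: "finer \<beta> \<U>"
      unfolding finer_def
    proof
      fix X assume "X \<in> \<beta>"
      then obtain A where A: "A \<in> \<alpha>" "X = Q A \<or> X = R \<inter> A" unfolding \<beta>_def by blast
      then have "X \<subseteq> V A" using V f(5)[OF A(1)] unfolding Q_def by blast
      then show "\<exists>V\<in>\<U>. X \<subseteq> V" using V A by blast
    qed
    define W where "W = (\<Inter>A\<in>\<alpha>. {\<nu> \<in> S. measure \<mu> A - t < (\<integral>x. f A x \<partial>\<nu>)})"
    have ne: "\<alpha> \<noteq> {}" using U\<alpha> by auto
    have "openin (weak_star_topology S) W"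
      unfolding W_def using f\<alpha> ne f(1)
      by (intro openin_INT2 openin_weak_star_integral_greater) auto
    moreover have "\<mu> \<in> W"
    proof -
      have "measure \<mu> A - t < (\<integral>x. f A x \<partial>\<mu>)" if A: "A \<in> \<alpha>" for A
      proof -
        have fm: "f A \<in> borel_measurable \<mu>"
          using borel_measurable_continuous_onI[OF f(1)[OF A]] s\<mu> by (simp cong: measurable_cong_sets)
        have KA: "K A \<in> sets \<mu>" using K A s\<mu> by simp
        have "measure \<mu> (K A) = (\<integral>x. indicator (K A) x \<partial>\<mu>)" using KA sets.sets_into_space by simp
        also have "\<dots> \<le> (\<integral>x. f A x \<partial>\<mu>)"
        proof (rule integral_mono)
          show "integrable \<mu> (indicator (K A) :: _ \<Rightarrow> real)"
            using KA \<mu>.emeasure_finite by (intro integrable_real_indicator) (auto simp: less_top[symmetric])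
          show "integrable \<mu> (f A)"
            using fm f(2,3)[OF A] by (intro \<mu>.integrable_const_bound[of _ 1]) auto
          show "indicator (K A) x \<le> f A x" for x
            using f(2,4)[OF A, of x] by (auto split: split_indicator)
        qed
        finally show ?thesis using K A by fastforce
      qed
      then show ?thesis unfolding W_def using \<mu>S by blast
    qed
    moreover have "W \<subseteq> {\<nu> \<in> S. entropy_cover \<nu> \<U> < a}"
    proof
      fix \<nu> assume \<nu>: "\<nu> \<in> W"
      then have \<nu>S: "\<nu> \<in> S" using ne unfolding W_def by blast
      interpret \<nu>: prob_space \<nu> using S \<nu>S by blast
      have s\<nu>: "sets \<nu> = sets borel" using S \<nu>S by blast
      have low: "measure \<mu> A - t < measure \<nu> (Q A)" if A: "A \<in> \<alpha>" for A
      proof -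
        have fm: "f A \<in> borel_measurable \<nu>"
          using borel_measurable_continuous_onI[OF f(1)[OF A]] s\<nu> by (simp cong: measurable_cong_sets)
        have OA: "Q A \<in> sets \<nu>" using mO A s\<nu> by simp
        have "measure \<mu> A - t < (\<integral>x. f A x \<partial>\<nu>)" using \<nu> A unfolding W_def by blast
        also have "\<dots> \<le> (\<integral>x. indicator (Q A) x \<partial>\<nu>)"
        proof (rule integral_mono)
          show "integrable \<nu> (indicator (Q A) :: _ \<Rightarrow> real)"
            using OA \<nu>.emeasure_finite by (intro integrable_real_indicator) (auto simp: less_top[symmetric])
          show "integrable \<nu> (f A)"
            using fm f(2,3)[OF A] by (intro \<nu>.integrable_const_bound[of _ 1]) auto
          show "f A x \<le> indicator (Q A) x" for x
            using f(2,3)[OF A, of x] by (auto simp: Q_def split: split_indicator)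
        qed
        also have "\<dots> = measure \<nu> (Q A)" using OA sets.sets_into_space by simp
        finally show ?thesis .
      qed
      have one: "(\<Sum>A\<in>\<alpha>. measure \<nu> (Q A)) + measure \<nu> R = 1"
      proof -
        have "measure \<nu> (\<Union>A\<in>\<alpha>. Q A) = (\<Sum>A\<in>\<alpha>. measure \<nu> (Q A))"
        proof (rule \<nu>.finite_measure_finite_Union[OF f\<alpha>])
          show "Q ` \<alpha> \<subseteq> sets \<nu>" using mO s\<nu> by auto
          show "disjoint_family_on Q \<alpha>"
            unfolding disjoint_family_on_def Q_def using f(6) by blast
        qed
        moreover have "measure \<nu> R = 1 - measure \<nu> (\<Union>A\<in>\<alpha>. Q A)"
        proof -
          have "space \<nu> = UNIV" using sets_eq_imp_space_eq[OF s\<nu>] by simp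
          moreover have "(\<Union>A\<in>\<alpha>. Q A) \<in> sets \<nu>" using mO f\<alpha> s\<nu> by (intro sets.finite_UN) auto
          ultimately show ?thesis unfolding R_def using \<nu>.prob_compl by metis
        qed
        ultimately show ?thesis by simp
      qed
      have sumlow: "(\<Sum>B\<in>\<alpha> - I. measure \<mu> B - t) \<le> (\<Sum>B\<in>\<alpha> - I. measure \<nu> (Q B))" for I
        using low by (intro sum_mono) (auto intro: less_imp_le)
      have R_small: "measure \<nu> R \<le> m * t"
        using sumlow[of "{}"] one tot[OF \<mu>S] by (simp add: sum_subtractf m_def)
      have close: "\<bar>measure \<nu> (Q A) - measure \<mu> A\<bar> < d" if A: "A \<in> \<alpha>" for A
      proof -
        have "card \<alpha> \<ge> 1" using A f\<alpha> by (metis One_nat_def Suc_leI card_gt_0_iff empty_iff)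
        then have m1: "m \<ge> 1" by (simp add: m_def)
        have "(\<Sum>B\<in>\<alpha> - {A}. measure \<mu> B - t) = (1 - measure \<mu> A) - (m - 1) * t"
          using tot[OF \<mu>S] A f\<alpha> \<open>card \<alpha> \<ge> 1\<close>
          by (simp add: sum_subtractf sum_diff1 m_def of_nat_diff)
        moreover have "(\<Sum>B\<in>\<alpha> - {A}. measure \<nu> (Q B)) \<le> 1 - measure \<nu> (Q A)"
          unfolding sum_diff1[OF f\<alpha>] using one A measure_nonneg[of \<nu> R] by (simp del: measure_nonneg)
        ultimately have "measure \<nu> (Q A) - measure \<mu> A \<le> (m - 1) * t"
          using sumlow[of "{A}"] by linarith
        then have "measure \<nu> (Q A) - measure \<mu> A < d" using t by (simp add: algebra_simps)
        moreover have "t \<le> m * t" using m1 t by simp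
        ultimately show ?thesis using low[OF A] t(2) by linarith
      qed
      have "entropy_partition \<nu> \<beta> \<le> entropy_partition \<nu> (Q ` \<alpha>) + entropy_partition \<nu> ((\<lambda>A. R \<inter> A) ` \<alpha>)"
        unfolding \<beta>_def using f\<alpha> by (intro entropy_partition_Un_le \<nu>.prob_space_axioms) auto
      also have "entropy_partition \<nu> (Q ` \<alpha>) \<le> (\<Sum>A\<in>\<alpha>. \<eta> (measure \<nu> (Q A)))"
        unfolding \<eta>_def by (rule entropy_partition_image_le[OF \<nu>.prob_space_axioms f\<alpha>])
      also have "\<dots> \<le> (\<Sum>A\<in>\<alpha>. \<eta> (measure \<mu> A) + e)"
      proof (rule sum_mono)
        fix A assume "A \<in> \<alpha>"
        then have "\<bar>\<eta> (measure \<nu> (Q A)) - \<eta> (measure \<mu> A)\<bar> < e" by (intro d close) auto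
        then show "\<eta> (measure \<nu> (Q A)) \<le> \<eta> (measure \<mu> A) + e" by linarith
      qed
      also have "\<dots> = entropy_partition \<mu> \<alpha> + m * e"
        by (simp only: sum.distrib sum_constant entropy_partition_def \<eta>_def m_def)
      also have "entropy_partition \<nu> ((\<lambda>A. R \<inter> A) ` \<alpha>) \<le> (\<Sum>A\<in>\<alpha>. \<eta> (measure \<nu> (R \<inter> A)))"
        unfolding \<eta>_def by (rule entropy_partition_image_le[OF \<nu>.prob_space_axioms f\<alpha>])
      also have "\<dots> \<le> (\<Sum>A\<in>\<alpha>. e)"
      proof (rule sum_mono)
        fix A assume "A \<in> \<alpha>"
        have "measure \<nu> (R \<inter> A) \<le> measure \<nu> R" using mR s\<nu> by (intro \<nu>.finite_measure_mono) auto
        then have "\<bar>measure \<nu> (R \<inter> A) - 0\<bar> < d" using R_small t(2) by simp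
        then have "\<bar>\<eta> (measure \<nu> (R \<inter> A)) - \<eta> 0\<bar> < e" by (intro d) auto
        then show "\<eta> (measure \<nu> (R \<inter> A)) \<le> e" by (simp add: \<eta>_def)
      qed
      also have "\<dots> = m * e" by (simp add: m_def)
      finally have "entropy_partition \<nu> \<beta> \<le> entropy_partition \<mu> \<alpha> + 2 * m * e" by (simp add: mult_ac)
      also have "\<dots> < entropy_partition \<mu> \<alpha> + (2 * m + 1) * e" using e by (simp add: algebra_simps)
      also have "\<dots> = a" unfolding e_def using m0 by simp
      finally have "entropy_cover \<nu> \<U> < a"
        using entropy_cover_le[OF \<nu>.prob_space_axioms p\<beta> fine\<beta>] by simp
      then show "\<nu> \<in> {\<nu> \<in> S. entropy_cover \<nu> \<U> < a}" using \<nu>S by simp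
    qed
    ultimately show "\<exists>T. openin (weak_star_topology S) T \<and> \<mu> \<in> T \<and>
        T \<subseteq> {\<nu> \<in> S. entropy_cover \<nu> \<U> < a}" by blast
  qed
qed

section \<open>Joins along an action\<close>

locale topological_action = group G for G :: "('g, 'b) monoid_scheme" (structure) +
  fixes \<phi> :: "'g \<Rightarrow> 'x::metric_space \<Rightarrow> 'x"
  assumes continuous_action: "\<And>g. g \<in> carrier G \<Longrightarrow> continuous_on UNIV (\<phi> g)"
    and action_mult: "\<And>g h x. g \<in> carrier G \<Longrightarrow> h \<in> carrier G \<Longrightarrow> \<phi> (g \<otimes>\<^bsub>G\<^esub> h) x = \<phi> g (\<phi> h x)"

lemma G_system_topological_action:
  assumes "group G" "G_system G \<phi>"
  shows "topological_action G \<phi>"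
proof -
  have act: "group_action G UNIV \<phi>" using assms by (simp add: G_system_def)
  have cont: "continuous_map (prod_topology (discrete_topology (carrier G)) euclidean) euclidean (\<lambda>(g, x). \<phi> g x)"
    using assms by (simp add: G_system_def)
  show ?thesis
  proof (intro topological_action.intro topological_action_axioms.intro assms(1))
    fix g assume g: "g \<in> carrier G"
    have "continuous_map euclidean (prod_topology (discrete_topology (carrier G)) euclidean) (\<lambda>x. (g, x))"
      using g by (intro continuous_map_pairedI) (auto simp: continuous_map_const)
    from continuous_map_compose[OF this cont] show "continuous_on UNIV (\<phi> g)"
      by (simp add: comp_def)
  next
    fix g h x assume "g \<in> carrier G" "h \<in> carrier G"
    then show "\<phi> (g \<otimes>\<^bsub>G\<^esub> h) x = \<phi> g (\<phi> h x)"
      using group_action.composition_rule[OF act] by simp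
  qed
qed

context topological_action
begin

lemma borel_measurable_action: "g \<in> carrier G \<Longrightarrow> \<phi> g \<in> borel_measurable borel"
  using continuous_action by (rule borel_measurable_continuous_onI)

lemma open_dyn_join:
  assumes F: "finite F" "F \<subseteq> carrier G" and op: "\<And>U. U \<in> \<U> \<Longrightarrow> open U" and D: "D \<in> dyn_join \<phi> \<U> F"
  shows "open D"
proof -
  obtain s where s: "s \<in> F \<rightarrow> \<U>" "D = (\<Inter>g\<in>F. \<phi> g -` s g)"
    using D unfolding dyn_join_def by blast
  have "open (\<phi> g -` s g)" if "g \<in> F" for g
  proof -
    have "open (s g)" using s(1) that op by blast
    moreover have "continuous_on UNIV (\<phi> g)" using continuous_action F(2) that by blast
    ultimately show ?thesis by (simp add: open_vimage)
  qed
  then show ?thesis unfolding s(2) using F(1) by (intro open_INT) auto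
qed

lemma finite_dyn_join:
  assumes "finite F" "finite \<U>"
  shows "finite (dyn_join \<phi> \<U> F)"
proof -
  have "dyn_join \<phi> \<U> F \<subseteq> (\<lambda>s. \<Inter>g\<in>F. \<phi> g -` s g) ` (F \<rightarrow>\<^sub>E \<U>)"
  proof
    fix D assume "D \<in> dyn_join \<phi> \<U> F"
    then obtain s where s: "s \<in> F \<rightarrow> \<U>" "D = (\<Inter>g\<in>F. \<phi> g -` s g)" unfolding dyn_join_def by blast
    then have "D = (\<Inter>g\<in>F. \<phi> g -` restrict s F g)" by simp
    moreover have "restrict s F \<in> F \<rightarrow>\<^sub>E \<U>" using s(1) by (simp add: restrict_PiE_iff Pi_iff)
    ultimately show "D \<in> (\<lambda>s. \<Inter>g\<in>F. \<phi> g -` s g) ` (F \<rightarrow>\<^sub>E \<U>)" by (rule image_eqI)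
  qed
  moreover have "finite (F \<rightarrow>\<^sub>E \<U>)" using assms by (intro finite_PiE) auto
  ultimately show ?thesis by (meson finite_imageI finite_subset)
qed

lemma Union_dyn_join:
  assumes "\<Union>\<U> = UNIV"
  shows "\<Union>(dyn_join \<phi> \<U> F) = UNIV"
proof -
  have "x \<in> \<Union>(dyn_join \<phi> \<U> F)" for x
  proof -
    have "\<forall>y. \<exists>U\<in>\<U>. y \<in> U" using assms by blast
    then obtain c where c: "\<And>y. c y \<in> \<U>" "\<And>y. y \<in> c y" by metis
    have "(\<Inter>g\<in>F. \<phi> g -` c (\<phi> g x)) \<in> dyn_join \<phi> \<U> F"
      unfolding dyn_join_def using c(1) by (intro CollectI exI[of _ "\<lambda>g. c (\<phi> g x)"]) auto
    moreover have "x \<in> (\<Inter>g\<in>F. \<phi> g -` c (\<phi> g x))" using c(2) by auto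
    ultimately show ?thesis by blast
  qed
  then show ?thesis by blast
qed

lemma borel_cover_dyn_join:
  assumes "finite F" "F \<subseteq> carrier G" "finite \<U>" "\<And>U. U \<in> \<U> \<Longrightarrow> open U" "\<Union>\<U> = UNIV"
  shows "borel_cover (dyn_join \<phi> \<U> F)"
proof -
  have "D \<in> sets borel" if "D \<in> dyn_join \<phi> \<U> F" for D
    using open_dyn_join[OF assms(1,2) assms(4) that] by simp
  then show ?thesis
    unfolding borel_cover_def using finite_dyn_join assms(1,3) Union_dyn_join[OF assms(5)] by blast
qed

text \<open>
  On the overlap of \<open>A\<close> and \<open>B\<close> either choice of members of \<open>\<U>\<close> works, so the sets need not be disjoint.
  This matters because the translates in a filling overlap.
\<close>

lemma finer_dyn_join_Un:
  assumes "finer \<alpha> (dyn_join \<phi> \<U> A)" "finer \<beta> (dyn_join \<phi> \<U> B)"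
  shows "finer ((\<lambda>(X, Y). X \<inter> Y) ` (\<alpha> \<times> \<beta>)) (dyn_join \<phi> \<U> (A \<union> B))"
  unfolding finer_def
proof (clarify)
  fix X Y assume XY: "X \<in> \<alpha>" "Y \<in> \<beta>"
  obtain D where D: "D \<in> dyn_join \<phi> \<U> A" "X \<subseteq> D" using assms(1) XY unfolding finer_def by blast
  obtain E where E: "E \<in> dyn_join \<phi> \<U> B" "Y \<subseteq> E" using assms(2) XY unfolding finer_def by blast
  obtain s where s: "s \<in> A \<rightarrow> \<U>" "D = (\<Inter>g\<in>A. \<phi> g -` s g)" using D(1) unfolding dyn_join_def by blast
  obtain t where t: "t \<in> B \<rightarrow> \<U>" "E = (\<Inter>g\<in>B. \<phi> g -` t g)" using E(1) unfolding dyn_join_def by blast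
  define r where "r g = (if g \<in> A then s g else t g)" for g
  have "r \<in> A \<union> B \<rightarrow> \<U>" using s(1) t(1) by (auto simp: r_def)
  then have "(\<Inter>g\<in>A \<union> B. \<phi> g -` r g) \<in> dyn_join \<phi> \<U> (A \<union> B)" unfolding dyn_join_def by blast
  moreover have "X \<inter> Y \<subseteq> (\<Inter>g\<in>A \<union> B. \<phi> g -` r g)"
  proof
    fix x assume "x \<in> X \<inter> Y"
    then have "x \<in> D" "x \<in> E" using D E by auto
    then show "x \<in> (\<Inter>g\<in>A \<union> B. \<phi> g -` r g)" unfolding s(2) t(2) r_def by auto
  qed
  ultimately show "\<exists>V\<in>dyn_join \<phi> \<U> (A \<union> B). X \<inter> Y \<subseteq> V" by blast
qed

text \<open>
  The join over \<open>F g\<close> is the preimage under the action of \<open>g\<close> of the join over \<open>F\<close>, because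
  \<open>(f g)\<^sup>-\<^sup>1 U = g\<^sup>-\<^sup>1 (f\<^sup>-\<^sup>1 U)\<close>.
\<close>

lemma finer_dyn_join_r_coset:
  assumes F: "F \<subseteq> carrier G" and g: "g \<in> carrier G" and "finer \<alpha> (dyn_join \<phi> \<U> F)"
  shows "finer ((\<lambda>A. \<phi> g -` A) ` \<alpha>) (dyn_join \<phi> \<U> (F #>\<^bsub>G\<^esub> g))"
  unfolding finer_def
proof (rule ballI, elim imageE)
  fix A' A assume A: "A \<in> \<alpha>" "A' = \<phi> g -` A"
  obtain D where D: "D \<in> dyn_join \<phi> \<U> F" "A \<subseteq> D" using assms(3) A unfolding finer_def by blast
  obtain s where s: "s \<in> F \<rightarrow> \<U>" "D = (\<Inter>f\<in>F. \<phi> f -` s f)" using D(1) unfolding dyn_join_def by blast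
  define r where "r h = s (h \<otimes> inv g)" for h
  have r: "r (f \<otimes> g) = s f" if "f \<in> F" for f
  proof -
    have "f \<in> carrier G" using that F by blast
    then show ?thesis using g by (simp add: r_def m_assoc)
  qed
  have "r \<in> (F #> g) \<rightarrow> \<U>" using r s(1) by (auto simp: r_coset_eq_image)
  then have "(\<Inter>h\<in>F #> g. \<phi> h -` r h) \<in> dyn_join \<phi> \<U> (F #> g)" unfolding dyn_join_def by blast
  moreover have "A' \<subseteq> (\<Inter>h\<in>F #> g. \<phi> h -` r h)"
  proof
    fix x assume "x \<in> A'"
    then have x: "\<phi> g x \<in> D" using A D by auto
    have "\<phi> (f \<otimes> g) x \<in> r (f \<otimes> g)" if f: "f \<in> F" for f
    proof -
      have "\<phi> (f \<otimes> g) x = \<phi> f (\<phi> g x)" using f F g by (intro action_mult) auto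
      also have "\<dots> \<in> s f" using x f unfolding s(2) by auto
      finally show ?thesis using r[OF f] by simp
    qed
    then show "x \<in> (\<Inter>h\<in>F #> g. \<phi> h -` r h)" by (auto simp: r_coset_eq_image)
  qed
  ultimately show "\<exists>V\<in>dyn_join \<phi> \<U> (F #> g). A' \<subseteq> V" by blast
qed

lemma entropy_partition_vimage_le:
  assumes \<mu>: "\<mu> \<in> invariant_measures G \<phi>" and g: "g \<in> carrier G" and \<alpha>: "borel_partition \<alpha>"
  shows "entropy_partition \<mu> ((\<lambda>A. \<phi> g -` A) ` \<alpha>) \<le> entropy_partition \<mu> \<alpha>"
proof -
  have p: "prob_space \<mu>" and s: "sets \<mu> = sets borel" and inv: "distr \<mu> borel (\<phi> g) = \<mu>"
    using \<mu> g by (auto simp: invariant_measures_def)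
  have fin: "finite \<alpha>" using \<alpha> by (simp add: borel_partition_def borel_cover_def)
  have sp: "space \<mu> = UNIV" using sets_eq_imp_space_eq[OF s] by simp
  have "measure \<mu> (\<phi> g -` A) = measure \<mu> A" if "A \<in> \<alpha>" for A
  proof -
    have "A \<in> sets borel" using that \<alpha> by (auto simp: borel_partition_def borel_cover_def)
    moreover have "\<phi> g \<in> measurable \<mu> borel"
      using borel_measurable_action[OF g] s by (simp cong: measurable_cong_sets)
    ultimately have "measure (distr \<mu> borel (\<phi> g)) A = measure \<mu> (\<phi> g -` A \<inter> space \<mu>)"
      by (intro measure_distr)
    then show ?thesis using inv sp by simp
  qed
  then have "(\<Sum>A\<in>\<alpha>. - measure \<mu> (\<phi> g -` A) * ln (measure \<mu> (\<phi> g -` A))) = entropy_partition \<mu> \<alpha>"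
    unfolding entropy_partition_def by (intro sum.cong) auto
  then show ?thesis using entropy_partition_image_le[OF p fin, of "\<lambda>A. \<phi> g -` A"] by simp
qed

text \<open>
  The constant \<open>card \<alpha>\<close> is the same for all invariant measures; this is what allows the tiles in
  \<open>uniform_ornstein_weiss\<close> to be chosen independently of the measure.
\<close>

lemma invariant_subadditive_entropy:
  assumes \<mu>: "\<mu> \<in> invariant_measures G \<phi>"
    and \<U>: "finite \<U>" "\<And>U. U \<in> \<U> \<Longrightarrow> open U" "\<Union>\<U> = UNIV"
    and \<alpha>: "borel_partition \<alpha>" "finer \<alpha> (dyn_join \<phi> \<U> {\<one>\<^bsub>G\<^esub>})"
  shows "invariant_subadditive G (card \<alpha>) (\<lambda>F. entropy_cover \<mu> (dyn_join \<phi> \<U> F))"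
proof -
  let ?h = "\<lambda>F. entropy_cover \<mu> (dyn_join \<phi> \<U> F)"
  have p: "prob_space \<mu>" and s: "sets \<mu> = sets borel"
    using \<mu> by (auto simp: invariant_measures_def)
  have cov: "borel_cover (dyn_join \<phi> \<U> F)" if "finite F" "F \<subseteq> carrier G" for F
    using that \<U> by (intro borel_cover_dyn_join)
  have sub: "?h (A \<union> B) \<le> ?h A + ?h B"
    if A: "finite A" "A \<subseteq> carrier G" and B: "finite B" "B \<subseteq> carrier G" for A B
  proof (rule field_le_epsilon)
    fix e :: real assume e: "e > 0"
    obtain \<beta> where \<beta>: "borel_partition \<beta>" "finer \<beta> (dyn_join \<phi> \<U> A)" "entropy_partition \<mu> \<beta> < ?h A + e/2"
      using entropy_cover_lessD[OF cov[OF A], of \<mu> "?h A + e/2"] e by auto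
    obtain \<gamma> where \<gamma>: "borel_partition \<gamma>" "finer \<gamma> (dyn_join \<phi> \<U> B)" "entropy_partition \<mu> \<gamma> < ?h B + e/2"
      using entropy_cover_lessD[OF cov[OF B], of \<mu> "?h B + e/2"] e by auto
    have "?h (A \<union> B) \<le> entropy_partition \<mu> ((\<lambda>(X, Y). X \<inter> Y) ` (\<beta> \<times> \<gamma>))"
      by (intro entropy_cover_le p borel_partition_join finer_dyn_join_Un \<beta> \<gamma>)
    also have "\<dots> \<le> entropy_partition \<mu> \<beta> + entropy_partition \<mu> \<gamma>"
      by (intro entropy_partition_join_le p s \<beta> \<gamma>)
    finally show "?h (A \<union> B) \<le> ?h A + ?h B + e" using \<beta>(3) \<gamma>(3) by simp
  qed
  have inv: "?h (A #> g) \<le> ?h A" if A: "finite A" "A \<subseteq> carrier G" and g: "g \<in> carrier G" for A g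
  proof (rule field_le_epsilon)
    fix e :: real assume e: "e > 0"
    obtain \<beta> where \<beta>: "borel_partition \<beta>" "finer \<beta> (dyn_join \<phi> \<U> A)" "entropy_partition \<mu> \<beta> < ?h A + e"
      using entropy_cover_lessD[OF cov[OF A], of \<mu> "?h A + e"] e by auto
    have "?h (A #> g) \<le> entropy_partition \<mu> ((\<lambda>A. \<phi> g -` A) ` \<beta>)"
      by (intro entropy_cover_le p borel_partition_vimage finer_dyn_join_r_coset borel_measurable_action A g \<beta>)
    also have "\<dots> \<le> entropy_partition \<mu> \<beta>" by (intro entropy_partition_vimage_le \<mu> g \<beta>)
    finally show "?h (A #> g) \<le> ?h A + e" using \<beta>(3) by simp
  qed
  have one: "?h {\<one>} \<le> card \<alpha>"
    using entropy_cover_le[OF p \<alpha>] entropy_partition_le_card[OF p, of \<alpha>] by linarith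
  have bound: "?h A \<le> real (card \<alpha>) * real (card A)" if "finite A" "A \<subseteq> carrier G" for A
    using that
  proof (induction A rule: finite_induct)
    case empty
    have "dyn_join \<phi> \<U> {} = {UNIV}" unfolding dyn_join_def by auto
    moreover have "borel_partition {UNIV :: 'x set}" by (simp add: borel_partition_def borel_cover_def)
    moreover have "finer {UNIV :: 'x set} {UNIV}" by (simp add: finer_def)
    moreover have "entropy_partition \<mu> {UNIV} = 0"
      using prob_space.prob_space[OF p] sets_eq_imp_space_eq[OF s] by (simp add: entropy_partition_def)
    ultimately show ?case using entropy_cover_le[OF p, of "{UNIV}" "{UNIV}"] by simp
  next
    case (insert g A)
    have "?h ({g} \<union> A) \<le> ?h {g} + ?h A" using insert by (intro sub) auto
    moreover have "?h ({\<one>} #> g) \<le> ?h {\<one>}" using insert by (intro inv) auto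
    moreover have "{\<one>} #> g = {g}" using insert by (simp add: r_coset_eq_image)
    ultimately show ?case using insert one by (simp add: algebra_simps)
  qed
  show ?thesis
    unfolding invariant_subadditive_def using sub inv bound by blast
qed

text \<open>
  Amenability provides a Folner sequence, without which the description of \<open>h\<^sub>\<mu>\<^sup>-(G, \<U>)\<close> as a common
  limit would not determine a number.
\<close>

lemma h_minus_limit:
  assumes am: "amenable G" and \<mu>: "\<mu> \<in> invariant_measures G \<phi>"
    and \<U>: "finite \<U>" "\<And>U. U \<in> \<U> \<Longrightarrow> open U" "\<Union>\<U> = UNIV"
  shows "0 \<le> h_minus G \<phi> \<mu> \<U>"
    and "folner_sequence G F \<Longrightarrow>
      (\<lambda>n. entropy_cover \<mu> (dyn_join \<phi> \<U> (F n)) / real (card (F n))) \<longlonglongrightarrow> h_minus G \<phi> \<mu> \<U>"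
proof -
  let ?lim = "\<lambda>h. \<forall>F. folner_sequence G F \<longrightarrow>
    (\<lambda>n. entropy_cover \<mu> (dyn_join \<phi> \<U> (F n)) / real (card (F n))) \<longlonglongrightarrow> h"
  have p: "prob_space \<mu>" using \<mu> by (simp add: invariant_measures_def)
  have "borel_cover (dyn_join \<phi> \<U> {\<one>})" using \<U> by (intro borel_cover_dyn_join) auto
  then obtain \<alpha> where \<alpha>: "borel_partition \<alpha>" "finer \<alpha> (dyn_join \<phi> \<U> {\<one>})"
    by (rule exists_finer_partition)
  have nonneg: "0 \<le> entropy_cover \<mu> (dyn_join \<phi> \<U> F)" if "F \<in> fin_subsets G" for F
    using that \<U> by (intro entropy_cover_nonneg p borel_cover_dyn_join) (auto simp: fin_subsets_def)
  obtain L where L: "0 \<le> L" "?lim L"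
    using ornstein_weiss[OF invariant_subadditive_entropy[OF \<mu> \<U> \<alpha>] of_nat_0_le_iff nonneg] by metis
  obtain F0 where F0: "folner_sequence G F0" using am unfolding amenable_def by blast
  have "h_minus G \<phi> \<mu> \<U> = L"
    unfolding h_minus_def
  proof (rule the_equality)
    show "?lim L" by (rule L(2))
    fix h assume "?lim h"
    then show "h = L" using F0 L(2) LIMSEQ_unique by blast
  qed
  then show "0 \<le> h_minus G \<phi> \<mu> \<U>"
    and "folner_sequence G F \<Longrightarrow>
      (\<lambda>n. entropy_cover \<mu> (dyn_join \<phi> \<U> (F n)) / real (card (F n))) \<longlonglongrightarrow> h_minus G \<phi> \<mu> \<U>"
    using L by simp_all
qed

lemma upper_semicontinuous_h_minus:
  assumes am: "amenable G" and \<U>: "finite \<U>" "\<And>U. U \<in> \<U> \<Longrightarrow> open U" "\<Union>\<U> = UNIV"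
  shows "upper_semicontinuous (weak_star_topology (invariant_measures G \<phi>)) (\<lambda>\<mu>. h_minus G \<phi> \<mu> \<U>)"
  unfolding upper_semicontinuous_def topspace_weak_star_topology
proof (intro allI)
  fix a :: real
  let ?M = "invariant_measures G \<phi>"
  let ?H = "\<lambda>\<nu> F. entropy_cover \<nu> (dyn_join \<phi> \<U> F)"
  have "borel_cover (dyn_join \<phi> \<U> {\<one>})" using \<U> by (intro borel_cover_dyn_join) auto
  then obtain \<alpha> where \<alpha>: "borel_partition \<alpha>" "finer \<alpha> (dyn_join \<phi> \<U> {\<one>})"
    by (rule exists_finer_partition)
  obtain F where F: "folner_sequence G F" using am unfolding amenable_def by blast
  show "openin (weak_star_topology ?M) {\<mu> \<in> ?M. h_minus G \<phi> \<mu> \<U> < a}"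
  proof (subst openin_subopen, rule ballI)
    fix \<mu> assume "\<mu> \<in> {\<mu> \<in> ?M. h_minus G \<phi> \<mu> \<U> < a}"
    then have \<mu>: "\<mu> \<in> ?M" and lt: "h_minus G \<phi> \<mu> \<U> < a" by auto
    obtain \<rho> where \<rho>: "h_minus G \<phi> \<mu> \<U> < \<rho>" "\<rho> < a" using dense[OF lt] by blast
    have \<rho>0: "0 \<le> \<rho>" using h_minus_limit(1)[OF am \<mu> \<U>] \<rho> by simp
    define \<eta> where "\<eta> = (a - \<rho>) / 2"
    have \<eta>: "0 < \<eta>" "\<rho> + \<eta> < a" using \<rho> by (auto simp: \<eta>_def field_simps)
    have "\<forall>\<^sub>F n in sequentially. ?H \<mu> (F n) / real (card (F n)) < \<rho>"
      using h_minus_limit(2)[OF am \<mu> \<U> F] \<rho>(1) by (rule order_tendstoD(2))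
    then have "\<forall>\<^sub>F n in sequentially. ?H \<mu> (F n) < \<rho> * real (card (F n))"
      by eventually_elim (use folner_sequence_card_pos[OF F] in \<open>simp add: pos_divide_less_eq\<close>)
    then have fr: "\<exists>\<^sub>F n in sequentially. ?H \<mu> (F n) < \<rho> * real (card (F n))"
      by (intro eventually_frequently) auto
    have inv: "has_invariant_sets G {T. ?H \<mu> T < \<rho> * real (card T)}"
      by (rule has_invariant_sets_frequently[where P = "\<lambda>T. ?H \<mu> T < \<rho> * real (card T)", OF F fr])
    obtain \<T> K \<delta> where R: "finite \<T>" "\<T> \<subseteq> {T. ?H \<mu> T < \<rho> * real (card T)} \<inter> fin_subsets G"
        "K \<in> fin_subsets G" "\<delta> > 0" "tile_bound G (card \<alpha>) \<rho> \<T> K \<delta> (\<rho> + \<eta>)"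
      by (rule uniform_ornstein_weiss[OF \<rho>0 of_nat_0_le_iff[of "card \<alpha>"] \<eta>(1) inv])
    define W where "W = (\<Inter>T\<in>\<T>. {\<nu> \<in> ?M. ?H \<nu> T < \<rho> * real (card T)}) \<inter> ?M"
    have "openin (weak_star_topology ?M) {\<nu> \<in> ?M. ?H \<nu> T < \<rho> * real (card T)}" if "T \<in> \<T>" for T
    proof -
      have T: "finite T" "T \<subseteq> carrier G" using that R(2) by (auto simp: fin_subsets_def)
      have "upper_semicontinuous (weak_star_topology ?M) (\<lambda>\<nu>. ?H \<nu> T)"
      proof (rule upper_semicontinuous_entropy_cover)
        show "prob_space \<nu> \<and> sets \<nu> = sets borel" if "\<nu> \<in> ?M" for \<nu>
          using that by (simp add: invariant_measures_def)
        show "finite (dyn_join \<phi> \<U> T)" using T \<U> by (intro finite_dyn_join)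
        show "open V" if "V \<in> dyn_join \<phi> \<U> T" for V using open_dyn_join[OF T \<U>(2) that] .
        show "\<Union>(dyn_join \<phi> \<U> T) = UNIV" by (rule Union_dyn_join[OF \<U>(3)])
      qed
      then show ?thesis by (simp add: upper_semicontinuous_def)
    qed
    then have "openin (weak_star_topology ?M) W"
      unfolding W_def
      using openin_INT[OF R(1), of "weak_star_topology ?M"] by (simp only: topspace_weak_star_topology)
    moreover have "\<mu> \<in> W" unfolding W_def using \<mu> R(2) by blast
    moreover have "W \<subseteq> {\<nu> \<in> ?M. h_minus G \<phi> \<nu> \<U> < a}"
    proof
      fix \<nu> assume W: "\<nu> \<in> W"
      then have \<nu>: "\<nu> \<in> ?M" unfolding W_def by blast
      have "?H \<nu> T \<le> \<rho> * real (card T)" if "T \<in> \<T>" for T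
        using W that unfolding W_def by (auto intro: less_imp_le)
      then have "\<forall>\<^sub>F n in sequentially. ?H \<nu> (F n) / real (card (F n)) \<le> \<rho> + \<eta>"
        by (intro tile_bound_eventually[OF F R(3,4,5) invariant_subadditive_entropy[OF \<nu> \<U> \<alpha>]])
      then have "h_minus G \<phi> \<nu> \<U> \<le> \<rho> + \<eta>"
        using h_minus_limit(2)[OF am \<nu> \<U> F] by (intro tendsto_upperbound) auto
      then show "\<nu> \<in> {\<nu> \<in> ?M. h_minus G \<phi> \<nu> \<U> < a}" using \<nu> \<eta> by simp
    qed
    ultimately show "\<exists>T. openin (weak_star_topology ?M) T \<and> \<mu> \<in> T \<and>
        T \<subseteq> {\<nu> \<in> ?M. h_minus G \<phi> \<nu> \<U> < a}" by blast
  qed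
qed

end

theorem proposition3p9:
  fixes G :: "('g, 'b) monoid_scheme"
    and \<phi> :: "'g \<Rightarrow> 'x::metric_space \<Rightarrow> 'x"
    and \<U> :: "'x set set"
  assumes "group G" and "countable (carrier G)" and "infinite (carrier G)" and "amenable G"
    and "G_system G \<phi>"
    and "finite \<U>" and "\<forall>U\<in>\<U>. open U" and "\<Union>\<U> = UNIV"
  shows "(\<lambda>\<mu>. h_minus G \<phi> \<mu> \<U>) \<in> invariant_measures G \<phi> \<rightarrow> {0..} \<and>
         upper_semicontinuous (weak_star_topology (invariant_measures G \<phi>))
           (\<lambda>\<mu>. h_minus G \<phi> \<mu> \<U>)"
proof -
  interpret topological_action G \<phi>
    using assms(1,5) by (rule G_system_topological_action)
  have op: "\<And>U. U \<in> \<U> \<Longrightarrow> open U" using assms(7) by blast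
  show ?thesis
    using h_minus_limit(1)[OF assms(4) _ assms(6) op assms(8)]
      upper_semicontinuous_h_minus[OF assms(4,6) op assms(8)] by simp
qed

end
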